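(* There is no polynomial $p$ such that for every XOR-clause-set $F$ there exists a CNF-representation $F'$ of $F$ with $\ell(F') \le p(\ell(F))$ and $\mathrm{hd}^{\mathrm{var}(F)}(F') \le 1$.
   Context: A literal is a variable $v$ or its complement $\overline{v}$; a clause is a finite set of literals not containing both $x$ and $\overline{x}$; a clause-set is a finite set of clauses; $\bot$ is the empty clause. For a clause-set $F$: $\mathrm{var}(F)$ is the set of variables occurring in it, $\ell(F)=\sum_{C\in F}|C|$. A partial assignment $\varphi$ maps a finite set $\mathrm{var}(\varphi)$ of variables to $\{0,1\}$ (with $\varphi(\overline v)=1-\varphi(v)$); $\varphi * F$ is obtained by deleting clauses containing a literal set to $1$ and deleting literals set to $0$ from the remaining clauses; $F$ is satisfiable iff $\varphi*F=\emptyset$ for some $\varphi$. $\langle x\to\varepsilon\rangle$ denotes the assignment giving literal $x$ value $\varepsilon$. Unit-clause propagation $r_1$: $r_1(F)=\{\bot\}$ if $\bot\in F$; $r_1(F)=F$ if all clauses have length $\ge 2$; otherwise for a unit clause $\{x\}\in F$, $r_1(F)=r_1(\langle x\to 1\rangle * F)$. More generally $r_0(F)=\{\bot\}$ if $\bot\in F$ and $F$ otherwise, and $r_{k+1}(F)=\{\bot\}$ if $r_k(F)=\{\bot\}$, else if there is a literal $x$ with $r_k(\langle x\to 0\rangle *F)=\{\bot\}$ then $r_{k+1}(F)=r_{k+1}(\langle x\to1\rangle*F)$, else $r_{k+1}(F)=F$. For a set $V$ of variables, the relative hardness $\mathrm{hd}^V(F)$ is the minimal $k\ge 0$ such that for all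 partial assignments $\varphi$ with $\mathrm{var}(\varphi)\subseteq V$ and $\varphi*F$ unsatisfiable we have $r_k(\varphi*F)=\{\bot\}$. An XOR-clause-set is a clause-set where each clause $C$ is interpreted as the XOR-constraint $\bigoplus_{x\in C} x = 0$ over $\mathbb{Z}_2$; a total assignment satisfies it iff every clause has an even number of literals set to $1$. A CNF-representation of an XOR-clause-set $F$ is a clause-set $F'$ with $\mathrm{var}(F)\subseteq \mathrm{var}(F')$ such that the restrictions to $\mathrm{var}(F)$ of the satisfying total assignments of $F'$ (as a CNF) are exactly the satisfying total assignments of $F$ (as XOR-clause-set). *)

theory Defs
  imports
    "HOL-Computational_Algebra.Polynomial"
    "HOL-Library.Infinite_Typeclass"
begin

section \<open>Clause-sets and partial assignments\<close>

datatype 'v literal = Pos 'v | Neg 'v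

fun var_lit :: "'v literal \<Rightarrow> 'v" where
  "var_lit (Pos v) = v"
| "var_lit (Neg v) = v"

type_synonym 'v clause = "'v literal set"
type_synonym 'v clause_set = "'v clause set"

definition is_clause :: "'v clause \<Rightarrow> bool" where
  "is_clause C \<longleftrightarrow> finite C \<and> (\<forall>v. \<not> (Pos v \<in> C \<and> Neg v \<in> C))"

definition is_clause_set :: "'v clause_set \<Rightarrow> bool" where
  "is_clause_set F \<longleftrightarrow> finite F \<and> (\<forall>C\<in>F. is_clause C)"

definition var :: "'v clause_set \<Rightarrow> 'v set" where
  "var F = (\<Union>C\<in>F. var_lit ` C)"

definition num_lits :: "'v clause_set \<Rightarrow> nat" where
  "num_lits F = (\<Sum>C\<in>F. card C)"

text \<open>A partial assignment is a map with finite domain.\<close>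

type_synonym 'v passign = "'v \<rightharpoonup> bool"

fun lit_val :: "'v passign \<Rightarrow> 'v literal \<Rightarrow> bool option" where
  "lit_val \<phi> (Pos v) = \<phi> v"
| "lit_val \<phi> (Neg v) = map_option Not (\<phi> v)"

definition apply_assign :: "'v passign \<Rightarrow> 'v clause_set \<Rightarrow> 'v clause_set" (infixr \<open>\<star>\<close> 65) where
  "\<phi> \<star> F = (\<lambda>C. {x \<in> C. lit_val \<phi> x \<noteq> Some False}) ` {C \<in> F. \<forall>x\<in>C. lit_val \<phi> x \<noteq> Some True}"

definition satisfiable :: "'v clause_set \<Rightarrow> bool" where
  "satisfiable F \<longleftrightarrow> (\<exists>\<phi>. finite (dom \<phi>) \<and> \<phi> \<star> F = {})"

text \<open>\<open>set_lit x \<epsilon>\<close> is the assignment of the variable of \<open>x\<close> that gives the literal \<open>x\<close> the value \<open>\<epsilon>\<close>.\<close>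

fun set_lit :: "'v literal \<Rightarrow> bool \<Rightarrow> 'v passign" where
  "set_lit (Pos v) \<epsilon> = [v \<mapsto> \<epsilon>]"
| "set_lit (Neg v) \<epsilon> = [v \<mapsto> \<not> \<epsilon>]"


section \<open>Generalised unit-clause propagation and relative hardness\<close>

text \<open>
  The recursion for $r_{k+1}$ leaves open which literal is assigned.
  \<open>reduction rk F G\<close> says that \<open>G\<close> is a final result of this recursion, for some choice of
  literals, when \<open>rk\<close> is the operator of the previous level. The set \<open>{{}}\<close> contains just the
  empty clause.
\<close>

inductive reduction :: "('v clause_set \<Rightarrow> 'v clause_set) \<Rightarrow> 'v clause_set \<Rightarrow> 'v clause_set \<Rightarrow> bool"
  for rk :: "'v clause_set \<Rightarrow> 'v clause_set" where
  refuted: "rk F = {{}} \<Longrightarrow> reduction rk F {{}}"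
| forced: "\<lbrakk>rk F \<noteq> {{}}; rk (set_lit x False \<star> F) = {{}}; reduction rk (set_lit x True \<star> F) G\<rbrakk>
    \<Longrightarrow> reduction rk F G"
| irreducible: "\<lbrakk>rk F \<noteq> {{}}; \<And>x. rk (set_lit x False \<star> F) \<noteq> {{}}\<rbrakk> \<Longrightarrow> reduction rk F F"

text \<open>
  On clause-sets the result exists and does not depend on the choices
  (\<open>ex1_reduction\<close> below), and the recursion equations hold for every choice of literal
  (\<open>red_Suc_refuted\<close>, \<open>red_Suc_forced\<close>, \<open>red_Suc_irreducible\<close>).
\<close>

primrec red :: "nat \<Rightarrow> 'v clause_set \<Rightarrow> 'v clause_set" where
  "red 0 F = (if {} \<in> F then {{}} else F)"
| "red (Suc k) F = (THE G. reduction (red k) F G)"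

text \<open>For clause-sets the minimum below is taken over a nonempty set (\<open>ex_hd_bound\<close>).\<close>

definition rel_hd :: "'v set \<Rightarrow> 'v clause_set \<Rightarrow> nat" where
  "rel_hd V F = (LEAST k. \<forall>\<phi>. finite (dom \<phi>) \<and> dom \<phi> \<subseteq> V \<and> \<not> satisfiable (\<phi> \<star> F)
     \<longrightarrow> red k (\<phi> \<star> F) = {{}})"


section \<open>XOR-clause-sets and their CNF-representations\<close>

text \<open>
  An XOR-clause-set is a clause-set, read differently. The total assignments of a clause-set \<open>F\<close>
  are the assignments with domain \<open>var F\<close>.
\<close>

definition cnf_models :: "'v clause_set \<Rightarrow> 'v passign set" where
  "cnf_models F = {\<phi>. dom \<phi> = var F \<and> \<phi> \<star> F = {}}"

definition xor_models :: "'v clause_set \<Rightarrow> 'v passign set" where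
  "xor_models F = {\<phi>. dom \<phi> = var F \<and> (\<forall>C\<in>F. even (card {x \<in> C. lit_val \<phi> x = Some True}))}"

definition is_cnf_representation :: "'v clause_set \<Rightarrow> 'v clause_set \<Rightarrow> bool" where
  "is_cnf_representation F' F \<longleftrightarrow> is_clause_set F' \<and> var F \<subseteq> var F' \<and>
     (\<lambda>\<phi>. \<phi> |` var F) ` cnf_models F' = xor_models F"


section \<open>Well-definedness\<close>

lemma is_clause_set_apply: "is_clause_set F \<Longrightarrow> is_clause_set (\<phi> \<star> F)"
  by (auto simp: is_clause_set_def is_clause_def apply_assign_def)

lemma finite_var: "is_clause_set F \<Longrightarrow> finite (var F)"
  by (auto simp: is_clause_set_def is_clause_def var_def)

lemma lit_val_add: "lit_val (\<phi> ++ \<psi>) x = (case lit_val \<psi> x of None \<Rightarrow> lit_val \<phi> x | Some b \<Rightarrow> Some b)"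
  by (cases x) (auto simp: map_add_def split: option.splits)

lemma apply_apply: "\<phi> \<star> \<psi> \<star> F = (\<phi> ++ \<psi>) \<star> F"
  unfolding apply_assign_def image_image
proof -
  let ?A = "\<lambda>\<theta> F. {C \<in> F. \<forall>x\<in>C. lit_val \<theta> x \<noteq> Some True}"
  let ?f = "\<lambda>\<theta> C. {x \<in> C. lit_val \<theta> x \<noteq> Some False}"
  have "lit_val \<psi> x \<noteq> Some True \<and> (lit_val \<psi> x \<noteq> Some False \<longrightarrow> lit_val \<phi> x \<noteq> Some True)
      \<longleftrightarrow> lit_val (\<phi> ++ \<psi>) x \<noteq> Some True" for x
    by (cases "lit_val \<psi> x") (auto simp: lit_val_add)
  then have "C \<in> ?A \<psi> F \<and> (\<forall>x\<in>?f \<psi> C. lit_val \<phi> x \<noteq> Some True) \<longleftrightarrow> C \<in> ?A (\<phi> ++ \<psi>) F" for C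
    by blast
  then have 1: "?A \<phi> (?f \<psi> ` ?A \<psi> F) = ?f \<psi> ` ?A (\<phi> ++ \<psi>) F"
    by blast
  have 2: "?f \<phi> (?f \<psi> C) = ?f (\<phi> ++ \<psi>) C" if "C \<in> ?A (\<phi> ++ \<psi>) F" for C
    using that by (auto simp: lit_val_add split: option.splits)
  show "?f \<phi> ` ?A \<phi> (?f \<psi> ` ?A \<psi> F) = ?f (\<phi> ++ \<psi>) ` ?A (\<phi> ++ \<psi>) F"
    unfolding 1 image_image using 2 by (intro image_cong) auto
qed

lemma dom_set_lit [simp]: "dom (set_lit x \<epsilon>) = {var_lit x}"
  by (cases x) auto

lemma apply_commute:
  "var_lit x \<noteq> var_lit y \<Longrightarrow> set_lit x a \<star> set_lit y b \<star> F = set_lit y b \<star> set_lit x a \<star> F"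
  by (simp add: apply_apply map_add_comm)

lemma set_lit_compl: "var_lit x = var_lit y \<Longrightarrow> x \<noteq> y \<Longrightarrow> set_lit x (\<not> \<epsilon>) = set_lit y \<epsilon>"
  by (cases x; cases y) auto

lemma lit_val_None: "lit_val \<phi> x = None \<longleftrightarrow> var_lit x \<notin> dom \<phi>"
  by (cases x) auto

lemma apply_id:
  assumes "dom \<phi> \<inter> var F = {}"
  shows "\<phi> \<star> F = F"
proof -
  have "lit_val \<phi> x = None" if "C \<in> F" "x \<in> C" for C x
    using assms that unfolding lit_val_None var_def by blast
  then have "{C \<in> F. \<forall>x\<in>C. lit_val \<phi> x \<noteq> Some True} = F"
    and "\<And>C. C \<in> F \<Longrightarrow> {x \<in> C. lit_val \<phi> x \<noteq> Some False} = C" by fastforce+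
  then show ?thesis by (simp add: apply_assign_def)
qed

lemma var_apply: "var (\<phi> \<star> F) \<subseteq> var F - dom \<phi>"
proof
  fix v assume "v \<in> var (\<phi> \<star> F)"
  then obtain C x where *: "C \<in> F" "\<forall>x\<in>C. lit_val \<phi> x \<noteq> Some True" "x \<in> C"
    "lit_val \<phi> x \<noteq> Some False" "v = var_lit x"
    by (auto simp: var_def apply_assign_def)
  then have "lit_val \<phi> x = None" by (metis (full_types) not_Some_eq)
  with * show "v \<in> var F - dom \<phi>" unfolding lit_val_None var_def by blast
qed

lemma ex_reduction:
  assumes "is_clause_set F"
  shows "\<exists>G. reduction rk F G"
  using assms
proof (induction "card (var F)" arbitrary: F rule: less_induct)
  case less
  show ?case
  proof (cases "rk F \<noteq> {{}} \<and> (\<exists>x. rk (set_lit x False \<star> F) = {{}})")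
    case True
    then obtain x where x: "rk F \<noteq> {{}}" "rk (set_lit x False \<star> F) = {{}}" by blast
    have v: "var_lit x \<in> var F"
    proof (rule ccontr)
      assume "var_lit x \<notin> var F"
      then have "set_lit x False \<star> F = F" by (intro apply_id) simp
      with x show False by simp
    qed
    have "var (set_lit x True \<star> F) \<subset> var F"
      using var_apply[of "set_lit x True" F] v unfolding dom_set_lit by blast
    then have "card (var (set_lit x True \<star> F)) < card (var F)"
      by (rule psubset_card_mono[OF finite_var[OF less.prems]])
    then have "\<exists>G. reduction rk (set_lit x True \<star> F) G"
      by (rule less.hyps[OF _ is_clause_set_apply[OF less.prems]])
    with x show ?thesis by (blast intro: forced)
  next
    case False
    then show ?thesis using refuted[of rk F] irreducible[of rk F] by blast
  qed
qed

lemma reduction_refuted_iff: "rk F = {{}} \<Longrightarrow> reduction rk F G \<longleftrightarrow> G = {{}}"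
  by (blast elim: reduction.cases intro: refuted)

text \<open>Confluence needs that refutations survive further assignments.\<close>

definition refutation_stable :: "('v clause_set \<Rightarrow> 'v clause_set) \<Rightarrow> bool" where
  "refutation_stable rk \<longleftrightarrow>
     (\<forall>F x. is_clause_set F \<and> rk F = {{}} \<longrightarrow> rk (set_lit x True \<star> F) = {{}})"

lemma set_lit_False: "\<exists>y. set_lit x False = set_lit y True"
  by (cases x) (metis set_lit.simps)+

lemma refutation_stableD:
  assumes "refutation_stable rk" "is_clause_set F" "rk F = {{}}"
  shows "rk (set_lit x a \<star> F) = {{}}"
proof (cases a)
  case False
  then show ?thesis using assms set_lit_False[of x] unfolding refutation_stable_def by metis
qed (use assms in \<open>auto simp: refutation_stable_def\<close>)

lemma reduction_forced_any:
  assumes "reduction rk F G" "refutation_stable rk" "is_clause_set F"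
    and "rk F \<noteq> {{}}" "rk (set_lit x False \<star> F) = {{}}"
  shows "reduction rk (set_lit x True \<star> F) G"
  using assms
proof (induction rule: reduction.induct)
  case (forced F y G)
  note st = refutation_stableD[OF \<open>refutation_stable rk\<close>]
  have cs: "is_clause_set (set_lit z a \<star> F)" for z a
    using forced.prems(2) by (rule is_clause_set_apply)
  consider "x = y" | "x \<noteq> y" "var_lit x = var_lit y" | "var_lit x \<noteq> var_lit y" by blast
  then show ?case
  proof cases
    case 1
    then show ?thesis using forced.hyps by simp
  next
    case 2
    then have "set_lit x True = set_lit y False" "set_lit y True = set_lit x False"
      using set_lit_compl[of x y False] set_lit_compl[of y x False] by auto
    then have "G = {{}}" using forced.prems(4) forced.hyps(3) by (simp add: reduction_refuted_iff)
    then show ?thesis using \<open>set_lit x True = set_lit y False\<close> forced.hyps(2)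
      by (simp add: reduction.refuted)
  next
    case 3
    note comm = apply_commute[OF 3]
    have yx: "rk (set_lit y False \<star> set_lit x True \<star> F) = {{}}"
      using st[of _ x True, OF cs forced.hyps(2)] by (simp add: comm)
    have "reduction rk (set_lit y True \<star> set_lit x True \<star> F) G"
    proof (cases "rk (set_lit y True \<star> F) = {{}}")
      case True
      then have "G = {{}}" using forced.hyps(3) by (simp add: reduction_refuted_iff)
      moreover have "rk (set_lit y True \<star> set_lit x True \<star> F) = {{}}"
        using st[of _ x True, OF cs True] by (simp add: comm)
      ultimately show ?thesis by (simp add: reduction.refuted)
    next
      case False
      have "rk (set_lit x False \<star> set_lit y True \<star> F) = {{}}"
        using st[of _ y True, OF cs forced.prems(4)] by (simp add: comm)
      then show ?thesis using forced.IH[OF forced.prems(1) cs False] by (simp add: comm)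
    qed
    note yxG = this
    show ?thesis
    proof (cases "rk (set_lit x True \<star> F) = {{}}")
      case True
      then have "G = {{}}" using yxG st[of _ y True, OF cs True] by (simp add: reduction_refuted_iff)
      then show ?thesis using reduction.refuted[of rk, OF True] by simp
    next
      case False
      then show ?thesis using yx yxG by (rule reduction.forced)
    qed
  qed
next
  case (refuted F)
  then show ?case by blast
next
  case (irreducible F)
  then show ?case by blast
qed

lemma reduction_unique:
  assumes "reduction rk F G" "reduction rk F H" "refutation_stable rk" "is_clause_set F"
  shows "G = H"
  using assms
proof (induction arbitrary: H rule: reduction.induct)
  case (refuted F)
  then show ?case by (simp add: reduction_refuted_iff)
next
  case (forced F x G)
  have "reduction rk (set_lit x True \<star> F) H"
    by (rule reduction_forced_any[OF forced.prems forced.hyps(1,2)])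
  then show ?case
    by (rule forced.IH[OF _ forced.prems(2) is_clause_set_apply[OF forced.prems(3)]])
next
  case (irreducible F)
  from irreducible.prems(1) irreducible.hyps show ?case
    by (cases rule: reduction.cases) simp_all
qed

lemma reduction_stable:
  assumes "reduction rk F {{}}" "refutation_stable rk" "is_clause_set F" "rk {{}} = {{}}"
  shows "reduction rk (set_lit y True \<star> F) {{}}"
  using assms
proof (induction F "{{}} :: 'a clause_set" rule: reduction.induct)
  case (refuted F)
  then have "rk (set_lit y True \<star> F) = {{}}" using refutation_stableD[of rk F y True] by simp
  then show ?case by (rule reduction.refuted)
next
  case (forced F x)
  note st = refutation_stableD[OF \<open>refutation_stable rk\<close>]
  have cs: "is_clause_set (set_lit z a \<star> F)" for z a
    using forced.prems(2) by (rule is_clause_set_apply)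
  consider "x = y" | "x \<noteq> y" "var_lit x = var_lit y" | "var_lit x \<noteq> var_lit y" by blast
  then show ?case
  proof cases
    case 1
    then show ?thesis using forced.hyps by simp
  next
    case 2
    then have "set_lit y True = set_lit x False"
      using set_lit_compl[of y x False] by auto
    then show ?thesis using forced.hyps(2) by (simp add: reduction.refuted)
  next
    case 3
    note comm = apply_commute[OF 3]
    have "rk (set_lit x False \<star> set_lit y True \<star> F) = {{}}"
      using st[of _ y True, OF cs forced.hyps(2)] by (simp add: comm)
    moreover have "reduction rk (set_lit x True \<star> set_lit y True \<star> F) {{}}"
      using forced.hyps(4) [OF forced.prems(1) cs forced.prems(3)] by (simp add: comm)
    ultimately show ?thesis
      by (cases "rk (set_lit y True \<star> F) = {{}}") (rule reduction.refuted reduction.forced; assumption)+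
  qed
next
  case irreducible
  then show ?case by simp
qed

lemma red_The:
  fixes F :: "'v clause_set"
  assumes "refutation_stable (red k :: 'v clause_set \<Rightarrow> _)" "is_clause_set F"
  shows "red (Suc k) F = G \<longleftrightarrow> reduction (red k) F G"
proof -
  have ex1: "\<exists>!G. reduction (red k) F G"
    using ex_reduction[OF assms(2), of "red k"] reduction_unique[of "red k" F, OF _ _ assms]
    by (rule ex_ex1I)
  show ?thesis
  proof
    assume "red (Suc k) F = G"
    with theI'[OF ex1] show "reduction (red k) F G" by simp
  next
    assume "reduction (red k) F G"
    with the1_equality[OF ex1] show "red (Suc k) F = G" by simp
  qed
qed

lemma is_clause_set_bot: "is_clause_set {{}}"
  by (auto simp: is_clause_set_def is_clause_def)

lemma red_stable:
  "refutation_stable (red k :: 'v clause_set \<Rightarrow> _) \<and> red k {{}} = ({{}} :: 'v clause_set)"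
proof (induction k)
  case 0
  have "{} \<in> set_lit x True \<star> F" if "{} \<in> F" for x :: "'v literal" and F
    unfolding apply_assign_def by (rule image_eqI[of _ _ "{}"]) (use that in auto)
  then show ?case by (auto simp: refutation_stable_def split: if_splits)
next
  case (Suc k)
  then have st: "refutation_stable (red k :: 'v clause_set \<Rightarrow> _)"
    and bot: "red k {{}} = ({{}} :: 'v clause_set)" by blast+
  note iff = red_The[OF st]
  have "red (Suc k) (set_lit x True \<star> F) = {{}}"
    if "is_clause_set F" "red (Suc k) F = {{}}" for F :: "'v clause_set" and x
  proof -
    have "reduction (red k) F {{}}" using iff[OF that(1)] that(2) by simp
    then have "reduction (red k) (set_lit x True \<star> F) {{}}"
      using st that(1) bot by (rule reduction_stable)
    then show ?thesis unfolding iff[OF is_clause_set_apply[OF that(1)]] .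
  qed
  moreover have "red (Suc k) {{}} = ({{}} :: 'v clause_set)"
    unfolding iff[OF is_clause_set_bot] using bot by (rule reduction.refuted)
  ultimately show ?case unfolding refutation_stable_def by blast
qed

lemma red_Suc_iff: "is_clause_set F \<Longrightarrow> red (Suc k) F = G \<longleftrightarrow> reduction (red k) F G"
  by (rule red_The[OF conjunct1[OF red_stable]])

theorem ex1_reduction: "is_clause_set F \<Longrightarrow> \<exists>!G. reduction (red k) F G"
  using red_Suc_iff[of F k] by metis

theorem red_Suc_refuted: "is_clause_set F \<Longrightarrow> red k F = {{}} \<Longrightarrow> red (Suc k) F = {{}}"
  using red_Suc_iff[of F k "{{}}"] reduction.refuted[of "red k" F] by blast

theorem red_Suc_forced:
  assumes "is_clause_set F" "red k F \<noteq> {{}}" "red k (set_lit x False \<star> F) = {{}}"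
  shows "red (Suc k) F = red (Suc k) (set_lit x True \<star> F)"
  unfolding red_Suc_iff[OF assms(1)]
  using assms(2,3) by (rule reduction.forced)
    (simp add: red_Suc_iff[symmetric] is_clause_set_apply assms(1) del: red.simps)

theorem red_Suc_irreducible:
  assumes "is_clause_set F" "red k F \<noteq> {{}}" "\<And>x. red k (set_lit x False \<star> F) \<noteq> {{}}"
  shows "red (Suc k) F = F"
  unfolding red_Suc_iff[OF assms(1)] using assms(2,3) by (rule reduction.irreducible)

lemma unsat_apply:
  assumes "\<not> satisfiable F" "finite (dom \<phi>)"
  shows "\<not> satisfiable (\<phi> \<star> F)"
  using assms unfolding satisfiable_def apply_apply by (metis dom_map_add finite_UnI)

lemma red_complete:
  assumes "is_clause_set F" "\<not> satisfiable F" "card (var F) \<le> k"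
  shows "red k F = {{}}"
  using assms
proof (induction k arbitrary: F)
  case 0
  then have "var F = {}" using finite_var[OF 0(1)] by simp
  then have "F \<subseteq> {{}}" by (auto simp: var_def)
  moreover have "F \<noteq> {}"
  proof
    assume "F = {}"
    then have "finite (dom Map.empty) \<and> Map.empty \<star> F = {}" by (simp add: apply_assign_def)
    then show False using 0(2) unfolding satisfiable_def by blast
  qed
  ultimately show ?case by auto
next
  case (Suc k)
  show ?case
  proof (cases "card (var F) \<le> k")
    case True
    then show ?thesis using Suc.IH[OF Suc.prems(1,2)] red_Suc_refuted[OF Suc.prems(1)] by blast
  next
    case False
    then obtain v where v: "v \<in> var F" by fastforce
    have *: "red k (set_lit (Pos v) a \<star> F) = {{}}" for a
    proof (rule Suc.IH)
      have "var (set_lit (Pos v) a \<star> F) \<subseteq> var F - {v}"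
        using var_apply[of "set_lit (Pos v) a" F] by simp
      then have "card (var (set_lit (Pos v) a \<star> F)) \<le> card (var F - {v})"
        by (intro card_mono) (simp_all add: finite_var Suc.prems)
      then show "card (var (set_lit (Pos v) a \<star> F)) \<le> k"
        using v Suc.prems by (simp add: finite_var)
    qed (use Suc.prems(1,2) is_clause_set_apply unsat_apply[of F "set_lit (Pos v) a"] in auto)
    have "red (Suc k) F = {{}}" if "red k F \<noteq> {{}}"
      using red_Suc_forced[OF Suc.prems(1) that, of "Pos v"] *
        red_Suc_refuted[OF is_clause_set_apply[OF Suc.prems(1)]] by metis
    then show ?thesis using red_Suc_refuted[OF Suc.prems(1)] by blast
  qed
qed

theorem ex_hd_bound:
  assumes "is_clause_set F"
  shows "\<exists>k. \<forall>\<phi>. finite (dom \<phi>) \<and> dom \<phi> \<subseteq> V \<and> \<not> satisfiable (\<phi> \<star> F)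
     \<longrightarrow> red k (\<phi> \<star> F) = {{}}"
proof (intro exI allI impI)
  fix \<phi> :: "'a passign"
  assume "finite (dom \<phi>) \<and> dom \<phi> \<subseteq> V \<and> \<not> satisfiable (\<phi> \<star> F)"
  moreover have "card (var (\<phi> \<star> F)) \<le> card (var F)"
    using var_apply[of \<phi> F] assms by (intro card_mono finite_var) auto
  ultimately show "red (card (var F)) (\<phi> \<star> F) = {{}}"
    using assms by (intro red_complete is_clause_set_apply) auto
qed

end

theory Submission
  imports Defs "HOL-Combinatorics.Permutations" "HOL-Library.Nat_Bijection"
begin

text \<open>
  The hard systems state that every vertex of $K_{n,n}$ has odd degree in the graph of true edge
  variables. If a representation \<open>F'\<close> has relative hardness at most 1, then unit propagation on \<open>F'\<close>
  decides, after the edges outside \<open>E\<close> have been set to false, whether \<open>E\<close> has an odd factor.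
  Unit propagation is a monotone computation with polynomially many gates in the size of \<open>F'\<close>, so
  a superpolynomial lower bound for monotone computations of this function suffices (Babai, Gal and
  Wigderson). It comes from Razborov's approximation method: each gate is approximated by a
  disjunction of few matchings with at most \<open>r\<close> edges. The approximations err on few perfect
  matchings, because a matching with \<open>r + 1\<close> edges extends to few permutations, and on few
  two-colourings, because in a long chain of matchings almost surely one is monochromatic. But the
  monochromatic graph of a colouring with an odd colour class has no odd factor, while a disjunction
  of small matchings accepts either no perfect matching or many such graphs.
\<close>

section \<open>Matchings and two-colourings\<close>

type_synonym edge = "nat \<times> nat"
type_synonym vertex = "nat + nat"

definition ends :: "edge set \<Rightarrow> vertex set" where
  "ends D = Inl ` fst ` D \<union> Inr ` snd ` D"

definition matching :: "edge set \<Rightarrow> bool" where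
  "matching D \<longleftrightarrow> finite D \<and> inj_on fst D \<and> inj_on snd D"

definition mono_edges :: "vertex set \<Rightarrow> edge set" where
  "mono_edges R = {(i, j). Inl i \<in> R \<longleftrightarrow> Inr j \<in> R}"

definition inside :: "vertex set \<Rightarrow> edge set" where
  "inside W = {(i, j). Inl i \<in> W \<and> Inr j \<in> W}"

lemma matching_subset: "matching D \<Longrightarrow> D' \<subseteq> D \<Longrightarrow> matching D'"
  by (auto simp: matching_def intro: finite_subset inj_on_subset)

lemma finite_ends: "finite D \<Longrightarrow> finite (ends D)"
  by (simp add: ends_def)

lemma card_ends:
  assumes "finite D"
  shows "card (ends D) \<le> 2 * card D"
proof -
  have "card (ends D) \<le> card (fst ` D) + card (snd ` D)"
    unfolding ends_def by (rule order.trans[OF card_Un_le]) (simp add: card_image)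
  also have "\<dots> \<le> card D + card D" using assms by (intro add_mono card_image_le)
  finally show ?thesis by simp
qed

lemma inside_finite:
  assumes "finite W"
  shows "finite (inside W)" "card (inside W) \<le> (card W)\<^sup>2"
proof -
  have inj: "inj_on (\<lambda>(i, j). (Inl i, Inr j) :: vertex \<times> vertex) (inside W)"
    by (auto simp: inj_on_def)
  have sub: "(\<lambda>(i, j). (Inl i, Inr j) :: vertex \<times> vertex) ` inside W \<subseteq> W \<times> W"
    by (auto simp: inside_def)
  show "finite (inside W)"
    using inj sub assms by (meson finite_SigmaI finite_imageD finite_subset)
  show "card (inside W) \<le> (card W)\<^sup>2"
    using card_inj_on_le[OF inj sub] assms by (simp add: power2_eq_square)
qed

text \<open>
  Every edge of a matching in a chain has an endpoint that no earlier matching touches. Recolouring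
  these endpoints makes the matching monochromatic without affecting the earlier ones.
\<close>

fun chain :: "vertex set \<Rightarrow> edge set list \<Rightarrow> bool" where
  "chain W [] \<longleftrightarrow> True"
| "chain W (D # Ds) \<longleftrightarrow> D \<inter> inside W = {} \<and> chain (W \<union> ends D) Ds"

text \<open>Reading \<open>R\<close> as a random colouring, \<B> is an event decided by the colours
  on \<open>W\<close>. This stands in for independence when the matchings of a chain are treated one
  after the other.\<close>

definition depends_on :: "vertex set \<Rightarrow> vertex set set \<Rightarrow> bool" where
  "depends_on W \<B> \<longleftrightarrow> (\<forall>R R'. R \<in> \<B> \<longrightarrow> R \<inter> W = R' \<inter> W \<longrightarrow> R' \<in> \<B>)"

lemma mono_edges_cong: "R \<inter> ends D = R' \<inter> ends D \<Longrightarrow> D \<subseteq> mono_edges R \<longleftrightarrow> D \<subseteq> mono_edges R'"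
proof -
  assume *: "R \<inter> ends D = R' \<inter> ends D"
  have "Inl i \<in> R \<longleftrightarrow> Inl i \<in> R'" "Inr j \<in> R \<longleftrightarrow> Inr j \<in> R'" if "(i, j) \<in> D" for i j
  proof -
    have "Inl i \<in> ends D" "Inr j \<in> ends D" using that by (force simp: ends_def)+
    then show "Inl i \<in> R \<longleftrightarrow> Inl i \<in> R'" "Inr j \<in> R \<longleftrightarrow> Inr j \<in> R'" using * by blast+
  qed
  then show ?thesis unfolding mono_edges_def by auto
qed

text \<open>Conditioned on \<B>, the matching is monochromatic with probability at least
  \<open>1 / 2 ^ r\<close>: give the fresh endpoint of each edge, which lies outside
  \<open>W\<close>, the colour of the other endpoint. Membership in \<B> survives, and a result
  arises from at most \<open>2 ^ r\<close> colourings, one for each lost pattern on the fresh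
  vertices.\<close>

lemma card_recolour:
  assumes fin: "finite V" and dep: "depends_on W \<B>"
    and D: "matching D" "card D \<le> r" "D \<inter> inside W = {}" "ends D \<subseteq> V"
  shows "card (\<B> \<inter> Pow V) \<le> 2 ^ r * card {R \<in> \<B> \<inter> Pow V. D \<subseteq> mono_edges R}"
proof -
  define fresh where "fresh = (\<lambda>(i, j). if Inl i \<in> W then Inr j else Inl i :: vertex)"
  define old where "old = (\<lambda>(i, j). if Inl i \<in> W then Inl i else Inr j :: vertex)"
  define Z where "Z = fresh ` D"
  have finD: "finite D" and inj: "inj_on fst D" "inj_on snd D"
    using D(1) by (auto simp: matching_def)
  have ends: "fresh e \<in> ends D" "old e \<in> ends D" if "e \<in> D" for e
    using that by (force simp: ends_def fresh_def old_def split: prod.splits)+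
  have fresh_W: "fresh e \<notin> W" if "e \<in> D" for e
    using that D(3) by (auto simp: fresh_def inside_def split: prod.splits)
  have inj_fresh: "inj_on fresh D"
  proof (rule inj_onI)
    fix e e' assume *: "e \<in> D" "e' \<in> D" "fresh e = fresh e'"
    have "fst e = fst e' \<or> snd e = snd e'"
      using *(3) by (simp add: fresh_def split: if_splits prod.splits)
    then show "e = e'" using *(1,2) inj by (auto dest: inj_onD)
  qed
  \<comment> \<open>Recolouring one edge must not disturb the colour copied for another. In a
    matching, a vertex shared by \<open>e\<close> and \<open>e'\<close> forces
    \<open>e = e'\<close>, and the two endpoints of one edge differ.\<close>
  have old_fresh: "old e \<noteq> fresh e'" if "e \<in> D" "e' \<in> D" for e e'
  proof
    assume *: "old e = fresh e'"
    then have "fst e = fst e' \<or> snd e = snd e'"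
      by (simp add: old_def fresh_def split: if_splits prod.splits)
    then have "e = e'" using that inj by (auto dest: inj_onD)
    then show False using * by (simp add: old_def fresh_def split: if_splits prod.splits)
  qed
  have Z: "Z \<inter> W = {}" "Z \<subseteq> V" "finite Z" "card Z \<le> r"
    using fresh_W ends D(2,4) finD card_image_le[OF finD, of fresh] by (auto simp: Z_def)
  define fix_col where "fix_col R = (R - Z) \<union> {fresh e | e. e \<in> D \<and> old e \<in> R}" for R
  have mono: "D \<subseteq> mono_edges (fix_col R)" for R
  proof
    fix e assume e: "e \<in> D"
    have f: "fresh e \<in> fix_col R \<longleftrightarrow> old e \<in> R"
      using e inj_fresh unfolding fix_col_def Z_def inj_on_def by blast
    have o: "old e \<in> fix_col R \<longleftrightarrow> old e \<in> R"
      using old_fresh[OF e] unfolding fix_col_def Z_def by blast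
    show "e \<in> mono_edges (fix_col R)"
      using f o by (cases e) (auto simp: mono_edges_def fresh_def old_def split: if_splits)
  qed
  have same: "fix_col R - Z = R - Z" for R
    by (auto simp: fix_col_def Z_def)
  let ?T = "{R \<in> \<B> \<inter> Pow V. D \<subseteq> mono_edges R}"
  \<comment> \<open>The overwritten colours on \<open>Z\<close> are recorded next to the result,
    which makes recolouring injective.\<close>
  have "inj_on (\<lambda>R. (fix_col R, R \<inter> Z)) (\<B> \<inter> Pow V)"
  proof (rule inj_onI)
    fix R R' assume "(fix_col R, R \<inter> Z) = (fix_col R', R' \<inter> Z)"
    then have "R - Z = R' - Z" "R \<inter> Z = R' \<inter> Z" using same[of R] same[of R'] by auto
    then show "R = R'" by blast
  qed
  moreover have "(\<lambda>R. (fix_col R, R \<inter> Z)) ` (\<B> \<inter> Pow V) \<subseteq> ?T \<times> Pow Z"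
  proof -
    have "fix_col R \<in> \<B>" if "R \<in> \<B>" for R
    proof -
      have "R \<inter> W = fix_col R \<inter> W" using same[of R] Z(1) by blast
      then show ?thesis using dep that unfolding depends_on_def by blast
    qed
    moreover have "fix_col R \<subseteq> V" if "R \<subseteq> V" for R
      using that Z(2) same[of R] by blast
    ultimately show ?thesis using mono by blast
  qed
  ultimately have "card (\<B> \<inter> Pow V) \<le> card (?T \<times> Pow Z)"
    using fin Z(3) by (intro card_inj_on_le) auto
  also have "\<dots> = card ?T * 2 ^ card Z" by (simp add: card_cartesian_product card_Pow Z(3))
  also have "\<dots> \<le> card ?T * 2 ^ r" using Z(4) by simp
  finally show ?thesis by (simp add: mult.commute)
qed

text \<open>Each matching of the chain fails to be monochromatic with conditional probability at
  most \<open>1 - 1 / 2 ^ r\<close>. This failure depends only on \<open>W\<close> and the endpoints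
  of the matching, so the induction continues with the enlarged vertex set, just as
  \<open>chain\<close> does.\<close>

lemma card_avoid_chain:
  assumes "finite V" "depends_on W \<B>" "chain W Ds"
    and "\<And>D. D \<in> set Ds \<Longrightarrow> matching D \<and> card D \<le> r \<and> ends D \<subseteq> V"
  shows "real (card {R \<in> \<B> \<inter> Pow V. \<forall>D\<in>set Ds. \<not> D \<subseteq> mono_edges R})
    \<le> (1 - 1 / 2 ^ r) ^ length Ds * real (card (\<B> \<inter> Pow V))"
  using assms(2-4)
proof (induction Ds arbitrary: W \<B>)
  case (Cons D Ds)
  define \<B>' where "\<B>' = {R \<in> \<B>. \<not> D \<subseteq> mono_edges R}"
  have dep: "depends_on (W \<union> ends D) \<B>'"
    unfolding depends_on_def
  proof (intro allI impI)
    fix R R' assume R: "R \<in> \<B>'" "R \<inter> (W \<union> ends D) = R' \<inter> (W \<union> ends D)"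
    have "R \<inter> W = R' \<inter> W" "R \<inter> ends D = R' \<inter> ends D" using R(2) by blast+
    then show "R' \<in> \<B>'"
      using R(1) Cons.prems(1) mono_edges_cong[of R D R'] unfolding \<B>'_def depends_on_def by blast
  qed
  have IH: "real (card {R \<in> \<B>' \<inter> Pow V. \<forall>D\<in>set Ds. \<not> D \<subseteq> mono_edges R})
    \<le> (1 - 1 / 2 ^ r) ^ length Ds * real (card (\<B>' \<inter> Pow V))"
    using Cons.prems by (intro Cons.IH[OF dep]) auto
  let ?T = "{R \<in> \<B> \<inter> Pow V. D \<subseteq> mono_edges R}"
  have "card (\<B> \<inter> Pow V) \<le> 2 ^ r * card ?T"
    using Cons.prems by (intro card_recolour[OF assms(1)]) auto
  then have "real (card (\<B> \<inter> Pow V)) \<le> 2 ^ r * real (card ?T)"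
    using of_nat_mono by fastforce
  then have T: "real (card (\<B> \<inter> Pow V)) / 2 ^ r \<le> real (card ?T)"
    by (simp add: field_simps)
  have "\<B> \<inter> Pow V = (\<B>' \<inter> Pow V) \<union> ?T" by (auto simp: \<B>'_def)
  also have "card \<dots> = card (\<B>' \<inter> Pow V) + card ?T"
    using assms(1) by (intro card_Un_disjoint) (auto simp: \<B>'_def)
  finally have "card (\<B> \<inter> Pow V) = card (\<B>' \<inter> Pow V) + card ?T" .
  with T have *: "real (card (\<B>' \<inter> Pow V)) \<le> (1 - 1 / 2 ^ r) * real (card (\<B> \<inter> Pow V))"
    by (simp add: algebra_simps add_divide_distrib)
  have "{R \<in> \<B> \<inter> Pow V. \<forall>D\<in>set (D # Ds). \<not> D \<subseteq> mono_edges R}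
      = {R \<in> \<B>' \<inter> Pow V. \<forall>D\<in>set Ds. \<not> D \<subseteq> mono_edges R}"
    by (auto simp: \<B>'_def)
  then show ?case
    using order.trans[OF IH mult_left_mono[OF *, of "(1 - 1 / 2 ^ r) ^ length Ds"]]
    by (simp add: mult.assoc mult.commute mult.left_commute)
next
  case Nil
  have "{R \<in> \<B> \<inter> Pow V. \<forall>D\<in>set []. \<not> D \<subseteq> mono_edges R} = \<B> \<inter> Pow V" by auto
  then show ?case by simp
qed

section \<open>A sunflower lemma for chains of matchings\<close>

text \<open>Greedy construction: a member of \<open>A\<close> without an edge inside
  \<open>W\<close> becomes the next matching of the chain, and its at most \<open>2 * r\<close>
  endpoints join \<open>W\<close>. If this gets stuck before \<open>k\<close> steps, every member
  has an edge inside the current \<open>W\<close>.\<close>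

lemma chain_or_cover:
  assumes "finite W" "\<And>D. D \<in> A \<Longrightarrow> finite D \<and> card D \<le> r"
  shows "(\<exists>Ds. length Ds = k \<and> set Ds \<subseteq> A \<and> chain W Ds)
    \<or> (\<exists>W'. finite W' \<and> card W' \<le> card W + 2 * r * k \<and> (\<forall>D\<in>A. D \<inter> inside W' \<noteq> {}))"
  using assms(1)
proof (induction k arbitrary: W)
  case (Suc k)
  show ?case
  proof (cases "\<exists>D\<in>A. D \<inter> inside W = {}")
    case True
    then obtain D where D: "D \<in> A" "D \<inter> inside W = {}" by blast
    have le: "card (W \<union> ends D) \<le> card W + 2 * r"
      using card_Un_le[of W "ends D"] card_ends[of D] assms(2)[OF D(1)] by linarith
    have "finite (W \<union> ends D)" using Suc.prems assms(2)[OF D(1)] finite_ends by blast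
    from Suc.IH[OF this] show ?thesis
    proof (elim disjE exE conjE)
      fix Ds assume "length Ds = k" "set Ds \<subseteq> A" "chain (W \<union> ends D) Ds"
      then show ?thesis using D by (intro disjI1 exI[of _ "D # Ds"]) auto
    next
      fix W' assume "finite W'" "card W' \<le> card (W \<union> ends D) + 2 * r * k" "\<forall>D\<in>A. D \<inter> inside W' \<noteq> {}"
      then show ?thesis using le by (intro disjI2 exI[of _ W']) auto
    qed
  next
    case False
    then show ?thesis using Suc.prems by (intro disjI2 exI[of _ W]) auto
  qed
qed simp

text \<open>The chain plays the role of the petals and \<open>M\<close> that of the core. Without a
  chain of length \<open>k\<close>, every member has an edge inside one set of at most
  \<open>2 * r * k\<close> vertices; some such edge lies in many members and moves into the core.
  The last conjunct is stated separately because the empty set may be repeated in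
  \<open>Ds\<close>.\<close>

lemma sunflower_chain:
  assumes "finite A" "\<And>D. D \<in> A \<Longrightarrow> finite D \<and> card D \<le> t" "t \<le> r"
    and "card A > ((2 * r * k)\<^sup>2) ^ t" "r > 0" "k > 0"
  shows "\<exists>M Ds. length Ds = k \<and> (\<forall>D\<in>set Ds. D \<inter> M = {} \<and> D \<union> M \<in> A) \<and> chain {} Ds
    \<and> card {D \<in> A. M \<subseteq> D} > 1"
  using assms(1-4)
proof (induction t arbitrary: A)
  case 0
  have "A \<subseteq> {{}}" using 0(2) by (metis card_0_eq le_zero_eq singletonI subsetI)
  then have "card A \<le> 1" using card_mono[of "{{}}" A] by simp
  then show ?case using 0 by simp
next
  case (Suc t)
  have bnd: "\<And>D. D \<in> A \<Longrightarrow> finite D \<and> card D \<le> r" using Suc.prems(2,3) by force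
  have "(\<exists>Ds. length Ds = k \<and> set Ds \<subseteq> A \<and> chain {} Ds) \<or>
    (\<exists>W. finite W \<and> card W \<le> card ({} :: vertex set) + 2 * r * k \<and> (\<forall>D\<in>A. D \<inter> inside W \<noteq> {}))"
    by (rule chain_or_cover) (use bnd in auto)
  then show ?case
  proof (elim disjE exE conjE)
    fix Ds assume Ds: "length Ds = k" "set Ds \<subseteq> A" "chain {} Ds"
    have "card A > 1"
    proof (rule le_less_trans[OF _ Suc.prems(4)])
      show "1 \<le> ((2 * r * k)\<^sup>2) ^ Suc t" using assms(5,6) by (intro one_le_power) simp
    qed
    then show ?thesis using Ds by (intro exI[of _ "{}"] exI[of _ Ds]) auto
  next
    fix W assume W: "finite W" "card W \<le> card ({} :: vertex set) + 2 * r * k" "\<forall>D\<in>A. D \<inter> inside W \<noteq> {}"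
    let ?I = "inside W" and ?B = "\<lambda>e. {D \<in> A. e \<in> D}" and ?L = "((2 * r * k)\<^sup>2) ^ t"
    have "(card W)\<^sup>2 \<le> (2 * r * k)\<^sup>2" using W(2) by (intro power_mono) auto
    then have I: "finite ?I" "card ?I \<le> (2 * r * k)\<^sup>2"
      using inside_finite[OF W(1)] by linarith+
    \<comment> \<open>Pigeonhole: at most \<open>(2 * r * k)\<^sup>2\<close> edges cover
      \<open>A\<close>, so one of them lies in more members than the threshold for
      \<open>t\<close>.\<close>
    have "\<exists>e\<in>?I. card (?B e) > ?L"
    proof (rule ccontr)
      assume "\<not> ?thesis"
      then have "(\<Sum>e\<in>?I. card (?B e)) \<le> of_nat (card ?I) * ?L"
        by (intro sum_bounded_above) (simp add: not_less)
      then have "card (\<Union>e\<in>?I. ?B e) \<le> card ?I * ?L"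
        using card_UN_le[OF I(1), of ?B] by simp
      also have "\<dots> \<le> ((2 * r * k)\<^sup>2) ^ Suc t"
        unfolding power_Suc using I(2) by (rule mult_le_mono1)
      finally have "card (\<Union>e\<in>?I. ?B e) < card A" using Suc.prems(4) by (rule le_less_trans)
      moreover have "A \<subseteq> (\<Union>e\<in>?I. ?B e)" using W(3) by blast
      moreover have "finite (\<Union>e\<in>?I. ?B e)" using Suc.prems(1) I(1) by auto
      ultimately show False using card_mono leD by blast
    qed
    then obtain e where e: "card (?B e) > ?L" by blast
    let ?A = "(\<lambda>D. D - {e}) ` ?B e"
    have inj: "inj_on (\<lambda>D. D - {e}) (?B e)" by (auto simp: inj_on_def)
    have "\<exists>M Ds. length Ds = k \<and> (\<forall>D\<in>set Ds. D \<inter> M = {} \<and> D \<union> M \<in> ?A) \<and> chain {} Ds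
        \<and> card {D \<in> ?A. M \<subseteq> D} > 1"
    proof (rule Suc.IH)
      show "card ?A > ?L" using e by (simp only: card_image[OF inj])
      show "finite D \<and> card D \<le> t" if A: "D \<in> ?A" for D
      proof -
        obtain D' where "D' \<in> A" "e \<in> D'" "D = D' - {e}" using A by blast
        then show ?thesis using Suc.prems(2)[of D'] by (simp add: le_diff_conv)
      qed
    qed (use Suc.prems(1,3) in simp_all)
    then obtain M Ds where M: "length Ds = k" "\<forall>D\<in>set Ds. D \<inter> M = {} \<and> D \<union> M \<in> ?A"
      "chain {} Ds" "card {D \<in> ?A. M \<subseteq> D} > 1" by (elim exE conjE) (rule that)
    show ?thesis
    proof (intro exI[of _ "insert e M"] exI[of _ Ds] conjI ballI)
      fix D assume "D \<in> set Ds"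
      note D = M(2)[rule_format, OF this]
      then have ne: "e \<notin> D \<union> M" by auto
      show "D \<inter> insert e M = {}" using D ne by blast
      obtain D' where "D' \<in> A" "e \<in> D'" "D \<union> M = D' - {e}" using D by auto
      moreover from this have "D \<union> insert e M = D'" by blast
      ultimately show "D \<union> insert e M \<in> A" by simp
    next
      have "{D \<in> ?A. M \<subseteq> D} \<subseteq> (\<lambda>D. D - {e}) ` {D \<in> A. insert e M \<subseteq> D}" by blast
      then have "card {D \<in> ?A. M \<subseteq> D} \<le> card {D \<in> A. insert e M \<subseteq> D}"
        using Suc.prems(1) by (simp add: surj_card_le)
      then show "1 < card {D \<in> A. insert e M \<subseteq> D}" using M(4) by linarith
    qed (use M in auto)
  qed
qed

section \<open>Plucking and its error on two-colourings\<close>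

definition accepts :: "edge set set \<Rightarrow> edge set \<Rightarrow> bool" where
  "accepts A E \<longleftrightarrow> (\<exists>M\<in>A. M \<subseteq> E)"

abbreviation verts :: "nat \<Rightarrow> vertex set" where
  "verts n \<equiv> Inl ` {..<n} \<union> Inr ` {..<n}"

abbreviation edges :: "nat \<Rightarrow> edge set" where
  "edges n \<equiv> {..<n} \<times> {..<n}"

lemma card_verts: "card (verts n) = 2 * n"
  by (subst card_Un_disjoint) (auto simp: card_image)

lemma ends_edges: "D \<subseteq> edges n \<Longrightarrow> ends D \<subseteq> verts n"
  by (auto simp: ends_def)

text \<open>While \<open>A\<close> is too large, all members containing a core \<open>M\<close> are
  replaced by \<open>M\<close>. Acceptance can only grow, and a newly accepted colouring has no
  monochromatic petal, which bounds the error of one round. Each round shrinks \<open>A\<close>, so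
  there are at most \<open>card A\<close> rounds.\<close>

lemma pluck:
  assumes "finite A" "\<forall>D\<in>A. matching D \<and> card D \<le> r \<and> D \<subseteq> edges n" "r > 0" "k > 0"
  shows "\<exists>A' N. finite A' \<and> (\<forall>D\<in>A'. matching D \<and> card D \<le> r \<and> D \<subseteq> edges n)
    \<and> card A' \<le> ((2 * r * k)\<^sup>2) ^ r \<and> (\<forall>E. accepts A E \<longrightarrow> accepts A' E)
    \<and> N \<subseteq> Pow (verts n) \<and> real (card N) \<le> card A * (2 ^ (2 * n) * (1 - 1 / 2 ^ r) ^ k)
    \<and> (\<forall>R \<in> Pow (verts n) - N. accepts A' (mono_edges R) \<longrightarrow> accepts A (mono_edges R))"
  using assms(1,2)
proof (induction "card A" arbitrary: A rule: less_induct)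
  case less
  let ?\<delta> = "2 ^ (2 * n) * (1 - 1 / 2 ^ r) ^ k :: real"
  have \<delta>: "?\<delta> \<ge> 0" by simp
  show ?case
  proof (cases "card A \<le> ((2 * r * k)\<^sup>2) ^ r")
    case True
    then show ?thesis using less.prems \<delta> by (intro exI[of _ A] exI[of _ "{}"]) auto
  next
    case False
    have "\<exists>M Ds. length Ds = k \<and> (\<forall>D\<in>set Ds. D \<inter> M = {} \<and> D \<union> M \<in> A) \<and> chain {} Ds
        \<and> card {D \<in> A. M \<subseteq> D} > 1"
    proof (rule sunflower_chain)
      show "card A > ((2 * r * k)\<^sup>2) ^ r" using False by (rule not_le_imp_less)
      show "finite D \<and> card D \<le> r" if "D \<in> A" for D
        using less.prems(2)[rule_format, OF that] by (simp add: matching_def)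
    qed (use less.prems(1) assms(3,4) in simp_all)
    then obtain M Ds where M: "length Ds = k" "\<forall>D\<in>set Ds. D \<inter> M = {} \<and> D \<union> M \<in> A"
      "chain {} Ds" "card {D \<in> A. M \<subseteq> D} > 1" by (elim exE conjE) (rule that)
    let ?U = "{D \<in> A. M \<subseteq> D}"
    define B where "B = insert M (A - ?U)"
    have finU: "finite ?U" using less.prems(1) by simp
    have "card ?U \<le> card A" using less.prems(1) by (simp add: card_mono)
    moreover have "card B \<le> Suc (card (A - ?U))"
      unfolding B_def using less.prems(1) by (simp add: card_insert_if)
    moreover have "card (A - ?U) = card A - card ?U" using finU by (rule card_Diff_subset) blast
    ultimately have cB: "card B < card A" using M(4) by linarith
    have "?U \<noteq> {}" using M(4) by (metis card.empty not_one_less_zero)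
    then obtain D0 where D0: "D0 \<in> A" "M \<subseteq> D0" by blast
    have Mok: "matching M \<and> card M \<le> r \<and> M \<subseteq> edges n"
      using less.prems(2)[rule_format, OF D0(1)] D0(2) matching_subset[of D0 M] card_mono[of D0 M]
      unfolding matching_def by (meson order_trans)
    have Bok: "finite B" "\<forall>D\<in>B. matching D \<and> card D \<le> r \<and> D \<subseteq> edges n"
      using less.prems Mok unfolding B_def by blast+
    from less.hyps[OF cB Bok] obtain A' N where A': "finite A'"
      "\<forall>D\<in>A'. matching D \<and> card D \<le> r \<and> D \<subseteq> edges n"
      "card A' \<le> ((2 * r * k)\<^sup>2) ^ r" "\<forall>E. accepts B E \<longrightarrow> accepts A' E"
      "N \<subseteq> Pow (verts n)" "real (card N) \<le> card B * ?\<delta>"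
      "\<forall>R \<in> Pow (verts n) - N. accepts A' (mono_edges R) \<longrightarrow> accepts B (mono_edges R)"
      by (elim exE conjE) (rule that)
    let ?N = "{R \<in> UNIV \<inter> Pow (verts n). \<forall>D\<in>set Ds. \<not> D \<subseteq> mono_edges R}"
    have "real (card ?N) \<le> (1 - 1 / 2 ^ r) ^ length Ds * real (card (UNIV \<inter> Pow (verts n)))"
    proof (rule card_avoid_chain[OF _ _ M(3)])
      fix D assume "D \<in> set Ds"
      then have *: "D \<union> M \<in> A" using M(2) by blast
      note ok = less.prems(2)[rule_format, OF *]
      then have "finite (D \<union> M)" by (simp add: matching_def)
      then have "matching D" "card D \<le> card (D \<union> M)" "D \<subseteq> edges n"
        using ok matching_subset[of "D \<union> M" D] card_mono[of "D \<union> M" D] by auto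
      then show "matching D \<and> card D \<le> r \<and> ends D \<subseteq> verts n"
        using ok ends_edges by auto
    qed (auto simp: depends_on_def)
    then have N: "real (card ?N) \<le> ?\<delta>"
      using card_verts[of n] by (simp add: card_Pow M(1) mult.commute)
    show ?thesis
    proof (intro exI[of _ A'] exI[of _ "N \<union> ?N"] conjI allI ballI impI)
      fix E assume "accepts A E"
      then have "accepts B E" by (auto simp: accepts_def B_def)
      then show "accepts A' E" using A'(4) by blast
    next
      have "card B + 1 \<le> card A" using cB by simp
      then have "real (card B) + 1 \<le> real (card A)" by linarith
      then have "(real (card B) + 1) * ?\<delta> \<le> real (card A) * ?\<delta>" using \<delta> by (rule mult_right_mono)
      moreover have "real (card (N \<union> ?N)) \<le> real (card N) + real (card ?N)"
        using card_Un_le[of N ?N] by linarith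
      ultimately show "real (card (N \<union> ?N)) \<le> real (card A) * ?\<delta>"
        using A'(6) N by (simp add: algebra_simps)
    next
      fix R assume R: "R \<in> Pow (verts n) - (N \<union> ?N)" "accepts A' (mono_edges R)"
      then have "accepts B (mono_edges R)" using A'(7) by blast
      then consider D where "D \<in> A" "D \<subseteq> mono_edges R" | "M \<subseteq> mono_edges R"
        by (auto simp: accepts_def B_def)
      then show "accepts A (mono_edges R)"
      proof cases
        case 2
        obtain D where "D \<in> set Ds" "D \<subseteq> mono_edges R" using R(1) by auto
        then have "D \<union> M \<in> A" "D \<union> M \<subseteq> mono_edges R" using M(2) 2 by auto
        then show ?thesis unfolding accepts_def by blast
      qed (auto simp: accepts_def)
    qed (use A' in auto)
  qed
qed

section \<open>Counting permutations and odd colour classes\<close>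

definition perm_edges :: "nat \<Rightarrow> (nat \<Rightarrow> nat) \<Rightarrow> edge set" where
  "perm_edges n \<sigma> = (\<lambda>i. (i, \<sigma> i)) ` {..<n}"

text \<open>Composing with the inverse of one such permutation \<tau> gives permutations that fix
  the \<open>m\<close> left endpoints of \<open>M\<close>, hence permutations of the other
  \<open>n - m\<close> points.\<close>

lemma card_perms_containing:
  assumes "finite M" "card M = m"
  shows "card {\<sigma>. \<sigma> permutes {..<n} \<and> M \<subseteq> perm_edges n \<sigma>} \<le> fact (n - m)"
proof (cases "\<exists>\<tau>. \<tau> permutes {..<n} \<and> M \<subseteq> perm_edges n \<tau>")
  case True
  then obtain \<tau> where \<tau>: "\<tau> permutes {..<n}" "M \<subseteq> perm_edges n \<tau>" by blast
  let ?S = "{\<sigma>. \<sigma> permutes {..<n} \<and> M \<subseteq> perm_edges n \<sigma>}" and ?A = "fst ` M"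
  have A: "?A \<subseteq> {..<n}" "card ?A = m"
  proof -
    show "?A \<subseteq> {..<n}" using \<tau>(2) by (auto simp: perm_edges_def)
    have "inj_on fst (perm_edges n \<tau>)" by (auto simp: perm_edges_def inj_on_def)
    then have "inj_on fst M" using \<tau>(2) by (rule inj_on_subset)
    then show "card ?A = m" using assms(2) card_image by blast
  qed
  have eq: "\<sigma> i = \<tau> i" if "i \<in> ?A" "\<sigma> \<in> ?S" for \<sigma> i
    using that \<tau>(2) by (force simp: perm_edges_def)
  have "inj_on (\<lambda>\<sigma>. inv \<tau> \<circ> \<sigma>) ?S"
  proof (rule inj_onI)
    fix \<sigma> \<sigma>' assume "inv \<tau> \<circ> \<sigma> = inv \<tau> \<circ> \<sigma>'"
    then have "\<tau> \<circ> (inv \<tau> \<circ> \<sigma>) = \<tau> \<circ> (inv \<tau> \<circ> \<sigma>')" by simp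
    then show "\<sigma> = \<sigma>'" using permutes_inv_o(1)[OF \<tau>(1)] by (simp add: comp_assoc[symmetric])
  qed
  moreover have "(\<lambda>\<sigma>. inv \<tau> \<circ> \<sigma>) ` ?S \<subseteq> {\<pi>. \<pi> permutes ({..<n} - ?A)}"
  proof clarify
    fix \<sigma> assume \<sigma>: "\<sigma> permutes {..<n}" "M \<subseteq> perm_edges n \<sigma>"
    show "inv \<tau> \<circ> \<sigma> permutes {..<n} - ?A"
    proof (rule permutes_superset[OF permutes_compose[OF \<sigma>(1) permutes_inv[OF \<tau>(1)]]])
      fix i assume "i \<in> {..<n} - ({..<n} - ?A)"
      then have "\<sigma> i = \<tau> i" using eq[of i \<sigma>] \<sigma> by auto
      then show "(inv \<tau> \<circ> \<sigma>) i = i" using permutes_inverses(2)[OF \<tau>(1)] by simp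
    qed
  qed
  ultimately have "card ?S \<le> card {\<pi>. \<pi> permutes ({..<n} - ?A)}"
    by (rule card_inj_on_le) (simp add: finite_permutations)
  also have "\<dots> = fact (n - m)"
    using A finite_subset[OF A(1)] by (subst card_permutations[OF refl]) (auto simp: card_Diff_subset)
  finally show ?thesis .
next
  case False
  then have "{\<sigma>. \<sigma> permutes {..<n} \<and> M \<subseteq> perm_edges n \<sigma>} = {}" by blast
  then show ?thesis by (simp only: card.empty le0)
qed

text \<open>For a fixed \<open>v\<close>, every subset of \<open>S - {v}\<close> has odd size either
  as it stands or after adding \<open>v\<close>.\<close>

lemma card_odd_subsets:
  assumes "finite S" "S \<noteq> {}"
  shows "2 ^ (card S - 1) \<le> card {R. R \<subseteq> S \<and> odd (card R)}"
proof -
  obtain v where v: "v \<in> S" using assms(2) by blast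
  let ?f = "\<lambda>T. if odd (card T) then T else insert v T"
  have "card (Pow (S - {v})) \<le> card {R. R \<subseteq> S \<and> odd (card R)}"
  proof (rule card_inj_on_le[of ?f])
    show "inj_on ?f (Pow (S - {v}))"
    proof (rule inj_onI)
      fix T T' assume "T \<in> Pow (S - {v})" "T' \<in> Pow (S - {v})" "?f T = ?f T'"
      then have "?f T - {v} = ?f T' - {v}" "v \<notin> T" "v \<notin> T'" by auto
      then show "T = T'" by (auto split: if_splits)
    qed
    show "?f ` Pow (S - {v}) \<subseteq> {R. R \<subseteq> S \<and> odd (card R)}"
    proof clarify
      fix T assume T: "T \<subseteq> S - {v}"
      then have "finite T" "v \<notin> T" using assms(1) by (auto intro: finite_subset)
      then show "?f T \<subseteq> S \<and> odd (card (?f T))" using T v by auto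
    qed
    show "finite {R. R \<subseteq> S \<and> odd (card R)}"
      by (rule finite_subset[of _ "Pow S"]) (use assms(1) in auto)
  qed
  then show ?thesis using assms(1) v by (simp add: card_Pow)
qed


section \<open>Approximation of monotone computations\<close>

text \<open>\<open>n\<close> is the size of each side of the bipartite graph, \<open>r\<close> the
  maximal size of a matching in an approximator, and \<open>k\<close> the length of the chains used
  in plucking.\<close>

locale approximation =
  fixes n r k :: nat
  assumes r: "0 < r" "r < n" and k: "0 < k"
begin

text \<open>The sunflower threshold, at which plucking stops.\<close>

definition bound :: nat where
  "bound = ((2 * r * k)\<^sup>2) ^ r"

text \<open>An upper bound for the number of colourings that avoid a chain of length
  \<open>k\<close>, hence for the error of one plucking round.\<close>

definition err :: real where
  "err = 2 ^ (2 * n) * (1 - 1 / 2 ^ r) ^ k"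

definition admissible :: "edge set \<Rightarrow> bool" where
  "admissible D \<longleftrightarrow> matching D \<and> card D \<le> r \<and> D \<subseteq> edges n"

definition approximator :: "edge set set \<Rightarrow> bool" where
  "approximator A \<longleftrightarrow> finite A \<and> card A \<le> bound \<and> (\<forall>D\<in>A. admissible D)"

abbreviation perms :: "(nat \<Rightarrow> nat) set" where
  "perms \<equiv> {\<sigma>. \<sigma> permutes {..<n}}"

lemma bound_pos: "1 \<le> bound"
  using r k unfolding bound_def by (intro one_le_power) simp

lemma err_nonneg: "0 \<le> err"
  by (simp add: err_def)

text \<open>The size \<open>2 * bound\<^sup>2\<close> serves both kinds of gate: before plucking, a
  disjunction has at most \<open>2 * bound\<close> matchings and a conjunction at most
  \<open>bound\<^sup>2\<close>.\<close>

lemma pluck_approximator: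
  assumes "finite A" "\<forall>D\<in>A. admissible D" "card A \<le> 2 * bound\<^sup>2"
  shows "\<exists>C N. approximator C \<and> (\<forall>E. accepts A E \<longrightarrow> accepts C E)
    \<and> N \<subseteq> Pow (verts n) \<and> real (card N) \<le> 2 * bound\<^sup>2 * err
    \<and> (\<forall>R \<in> Pow (verts n) - N. accepts C (mono_edges R) \<longrightarrow> accepts A (mono_edges R))"
proof -
  have "\<exists>C N. finite C \<and> (\<forall>D\<in>C. admissible D) \<and> card C \<le> bound \<and> (\<forall>E. accepts A E \<longrightarrow> accepts C E)
    \<and> N \<subseteq> Pow (verts n) \<and> real (card N) \<le> card A * err
    \<and> (\<forall>R \<in> Pow (verts n) - N. accepts C (mono_edges R) \<longrightarrow> accepts A (mono_edges R))"
    unfolding admissible_def bound_def err_def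
    by (rule pluck[OF assms(1) _ r(1) k]) (use assms(2) in \<open>simp add: admissible_def\<close>)
  then obtain C N where C: "finite C"
    "\<forall>D\<in>C. admissible D" "card C \<le> bound"
    "\<forall>E. accepts A E \<longrightarrow> accepts C E" "N \<subseteq> Pow (verts n)" "real (card N) \<le> card A * err"
    "\<forall>R \<in> Pow (verts n) - N. accepts C (mono_edges R) \<longrightarrow> accepts A (mono_edges R)"
    by (elim exE conjE) (rule that)
  have "real (card A) \<le> 2 * (real bound)\<^sup>2" using assms(3)
    by (metis of_nat_le_iff of_nat_mult of_nat_numeral of_nat_power)
  then have "real (card A) * err \<le> 2 * (real bound)\<^sup>2 * err"
    using err_nonneg by (rule mult_right_mono)
  then show ?thesis using C
    by (intro exI[of _ C] exI[of _ N]) (auto simp: approximator_def admissible_def)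
qed

text \<open>Plucking never shrinks acceptance, so a disjunction errs on colourings only.\<close>

lemma approximator_disj:
  assumes "approximator A" "approximator B"
  shows "\<exists>C N. approximator C \<and> (\<forall>E. accepts A E \<or> accepts B E \<longrightarrow> accepts C E)
    \<and> N \<subseteq> Pow (verts n) \<and> real (card N) \<le> 2 * bound\<^sup>2 * err
    \<and> (\<forall>R \<in> Pow (verts n) - N. accepts C (mono_edges R) \<longrightarrow>
        accepts A (mono_edges R) \<or> accepts B (mono_edges R))"
proof -
  have "card (A \<union> B) \<le> bound + bound"
    using assms card_Un_le[of A B] unfolding approximator_def by linarith
  also have "\<dots> \<le> 2 * bound\<^sup>2" using self_le_power[OF bound_pos, of 2] by simp
  finally have "card (A \<union> B) \<le> 2 * bound\<^sup>2" .
  with assms have "\<exists>C N. approximator C \<and> (\<forall>E. accepts (A \<union> B) E \<longrightarrow> accepts C E)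
    \<and> N \<subseteq> Pow (verts n) \<and> real (card N) \<le> 2 * bound\<^sup>2 * err
    \<and> (\<forall>R \<in> Pow (verts n) - N. accepts C (mono_edges R) \<longrightarrow> accepts (A \<union> B) (mono_edges R))"
    by (intro pluck_approximator) (auto simp: approximator_def)
  moreover have "accepts (A \<union> B) E \<longleftrightarrow> accepts A E \<or> accepts B E" for E
    by (auto simp: accepts_def)
  ultimately show ?thesis by simp
qed

lemma matching_perm_edges: "\<sigma> permutes {..<n} \<Longrightarrow> matching (perm_edges n \<sigma>)"
  by (auto simp: matching_def perm_edges_def inj_on_def dest: permutes_inj[THEN injD])

text \<open>Distributing the conjunction gives the unions of pairs. Unions that are not matchings
  lie in no permutation, and unions with more than \<open>r\<close> edges lie in few permutations
  each; the latter make up \<open>P\<close>. Dropping both kinds cannot enlarge acceptance, so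
  \<open>N\<close> comes from plucking alone.\<close>

lemma approximator_conj:
  assumes "approximator A" "approximator B"
  shows "\<exists>C P N. approximator C
    \<and> P \<subseteq> perms \<and> card P \<le> bound\<^sup>2 * fact (n - Suc r)
    \<and> N \<subseteq> Pow (verts n) \<and> real (card N) \<le> 2 * bound\<^sup>2 * err
    \<and> (\<forall>\<sigma> \<in> perms - P. accepts A (perm_edges n \<sigma>) \<and> accepts B (perm_edges n \<sigma>) \<longrightarrow>
        accepts C (perm_edges n \<sigma>))
    \<and> (\<forall>R \<in> Pow (verts n) - N. accepts C (mono_edges R) \<longrightarrow>
        accepts A (mono_edges R) \<and> accepts B (mono_edges R))"
proof -
  define X where "X = (\<lambda>(D, D'). D \<union> D') ` (A \<times> B)"
  define Y where "Y = {D \<in> X. admissible D}"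
  define Z where "Z = {D \<in> X. r < card D}"
  define P where "P = (\<Union>D\<in>Z. {\<sigma>. \<sigma> permutes {..<n} \<and> D \<subseteq> perm_edges n \<sigma>})"
  have fin: "finite A" "finite B" "card A \<le> bound" "card B \<le> bound"
    using assms by (auto simp: approximator_def)
  then have finX: "finite X" by (simp add: X_def)
  have "card X \<le> card (A \<times> B)" unfolding X_def using fin by (intro card_image_le) simp
  also have "\<dots> \<le> bound\<^sup>2"
    using fin by (simp add: card_cartesian_product power2_eq_square mult_le_mono)
  finally have cX: "card X \<le> bound\<^sup>2" .
  have finD: "finite D" if "D \<in> X" for D
    using that assms by (auto simp: X_def approximator_def admissible_def matching_def)
  have sub: "D \<subseteq> edges n" if "D \<in> X" for D
    using that assms by (fastforce simp: X_def approximator_def admissible_def)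
  have "card Y \<le> 2 * bound\<^sup>2" "card Z \<le> bound\<^sup>2"
    using card_mono[OF finX, of Y] card_mono[OF finX, of Z] cX by (auto simp: Y_def Z_def)
  have "\<exists>C N. approximator C \<and> (\<forall>E. accepts Y E \<longrightarrow> accepts C E)
    \<and> N \<subseteq> Pow (verts n) \<and> real (card N) \<le> 2 * bound\<^sup>2 * err
    \<and> (\<forall>R \<in> Pow (verts n) - N. accepts C (mono_edges R) \<longrightarrow> accepts Y (mono_edges R))"
    using finX \<open>card Y \<le> 2 * bound\<^sup>2\<close> by (intro pluck_approximator) (auto simp: Y_def)
  then obtain C N where C: "approximator C" "\<And>E. accepts Y E \<Longrightarrow> accepts C E"
    "N \<subseteq> Pow (verts n)" "real (card N) \<le> 2 * bound\<^sup>2 * err"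
    "\<And>R. R \<in> Pow (verts n) - N \<Longrightarrow> accepts C (mono_edges R) \<Longrightarrow> accepts Y (mono_edges R)"
    by metis
  have "card P \<le> (\<Sum>D\<in>Z. card {\<sigma>. \<sigma> permutes {..<n} \<and> D \<subseteq> perm_edges n \<sigma>})"
    unfolding P_def using finX by (intro card_UN_le) (simp add: Z_def)
  also have "\<dots> \<le> of_nat (card Z) * fact (n - Suc r)"
  proof (rule sum_bounded_above)
    fix D assume D: "D \<in> Z"
    have "card {\<sigma>. \<sigma> permutes {..<n} \<and> D \<subseteq> perm_edges n \<sigma>} \<le> fact (n - card D)"
      using D finD by (intro card_perms_containing) (auto simp: Z_def)
    also have "\<dots> \<le> fact (n - Suc r)" using D by (intro fact_mono diff_le_mono2) (simp add: Z_def Suc_le_eq)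
    finally show "card {\<sigma>. \<sigma> permutes {..<n} \<and> D \<subseteq> perm_edges n \<sigma>} \<le> fact (n - Suc r)" .
  qed
  also have "\<dots> \<le> bound\<^sup>2 * fact (n - Suc r)" using \<open>card Z \<le> bound\<^sup>2\<close> by simp
  finally have P: "card P \<le> bound\<^sup>2 * fact (n - Suc r)" .
  have Y_imp: "accepts A E \<and> accepts B E" if "accepts Y E" for E
    using that by (auto simp: accepts_def Y_def X_def)
  have "accepts Y (perm_edges n \<sigma>)"
    if \<sigma>: "\<sigma> \<in> perms - P" and acc: "accepts A (perm_edges n \<sigma>)" "accepts B (perm_edges n \<sigma>)" for \<sigma>
  proof -
    obtain D D' where D: "D \<in> A" "D' \<in> B" "D \<union> D' \<subseteq> perm_edges n \<sigma>"
      using acc unfolding accepts_def by blast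
    then have X: "D \<union> D' \<in> X" by (auto simp: X_def)
    moreover have "matching (D \<union> D')"
      using D(3) \<sigma> matching_perm_edges matching_subset by blast
    moreover have "card (D \<union> D') \<le> r"
      using \<sigma> D(3) X by (auto simp: P_def Z_def not_less)
    ultimately have "D \<union> D' \<in> Y" using sub[OF X] by (simp add: Y_def admissible_def)
    then show ?thesis using D(3) unfolding accepts_def by blast
  qed
  then show ?thesis using C P Y_imp
    by (intro exI[of _ C] exI[of _ P] exI[of _ N]) (auto simp: P_def)
qed

text \<open>
  \<open>approximable g G\<close> abstracts from "the functions in \<open>G\<close> are computed by a monotone circuit with
  \<open>g\<close> gates": all that is kept of the circuit is a bound on the total error of the approximators.
  The positive test inputs are the perfect matchings given by permutations, the negative ones are the
  monochromatic graphs of two-colourings.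
\<close>

definition approximable :: "nat \<Rightarrow> (edge set \<Rightarrow> bool) set \<Rightarrow> bool" where
  "approximable g G \<longleftrightarrow> (\<exists>P N. P \<subseteq> perms \<and> card P \<le> g * (bound\<^sup>2 * fact (n - Suc r))
    \<and> N \<subseteq> Pow (verts n) \<and> real (card N) \<le> g * (2 * bound\<^sup>2 * err)
    \<and> (\<forall>f\<in>G. \<exists>A. approximator A
        \<and> (\<forall>\<sigma> \<in> perms - P. f (perm_edges n \<sigma>) \<longrightarrow> accepts A (perm_edges n \<sigma>))
        \<and> (\<forall>R \<in> Pow (verts n) - N. accepts A (mono_edges R) \<longrightarrow> f (mono_edges R))))"

lemma approximable_subset: "approximable g G \<Longrightarrow> G' \<subseteq> G \<Longrightarrow> approximable g G'"
  unfolding approximable_def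
  by (elim exE conjE, rule exI, rule exI, intro conjI, assumption+) blast

text \<open>The error sets are common to all functions in \<open>G\<close>, so a new gate adds only
  the error of its own approximation step. Monotonicity of \<open>c\<close> carries the one-sided
  guarantees for the two arguments through the gate.\<close>

lemma approximable_gate:
  assumes G: "approximable g G" "f1 \<in> G" "f2 \<in> G"
    and gate: "\<And>A B. approximator A \<Longrightarrow> approximator B \<Longrightarrow> \<exists>C P N. approximator C
      \<and> P \<subseteq> perms \<and> card P \<le> bound\<^sup>2 * fact (n - Suc r)
      \<and> N \<subseteq> Pow (verts n) \<and> real (card N) \<le> 2 * bound\<^sup>2 * err
      \<and> (\<forall>\<sigma> \<in> perms - P. c (accepts A (perm_edges n \<sigma>)) (accepts B (perm_edges n \<sigma>)) \<longrightarrow>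
          accepts C (perm_edges n \<sigma>))
      \<and> (\<forall>R \<in> Pow (verts n) - N. accepts C (mono_edges R) \<longrightarrow>
          c (accepts A (mono_edges R)) (accepts B (mono_edges R)))"
    and mono: "\<And>p q p' q'. c p q \<Longrightarrow> (p \<longrightarrow> p') \<Longrightarrow> (q \<longrightarrow> q') \<Longrightarrow> c p' q'"
  shows "approximable (g + 1) (insert (\<lambda>E. c (f1 E) (f2 E)) G)"
proof -
  from G(1) obtain P N where PN: "P \<subseteq> perms" "card P \<le> g * (bound\<^sup>2 * fact (n - Suc r))"
    "N \<subseteq> Pow (verts n)" "real (card N) \<le> g * (2 * bound\<^sup>2 * err)"
    and appr: "\<forall>f\<in>G. \<exists>A. approximator A
        \<and> (\<forall>\<sigma> \<in> perms - P. f (perm_edges n \<sigma>) \<longrightarrow> accepts A (perm_edges n \<sigma>))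
        \<and> (\<forall>R \<in> Pow (verts n) - N. accepts A (mono_edges R) \<longrightarrow> f (mono_edges R))"
    unfolding approximable_def by (elim exE conjE) (rule that)
  from bspec[OF appr G(2)] obtain A where A: "approximator A"
    "\<forall>\<sigma> \<in> perms - P. f1 (perm_edges n \<sigma>) \<longrightarrow> accepts A (perm_edges n \<sigma>)"
    "\<forall>R \<in> Pow (verts n) - N. accepts A (mono_edges R) \<longrightarrow> f1 (mono_edges R)"
    by (elim exE conjE) (rule that)
  from bspec[OF appr G(3)] obtain B where B: "approximator B"
    "\<forall>\<sigma> \<in> perms - P. f2 (perm_edges n \<sigma>) \<longrightarrow> accepts B (perm_edges n \<sigma>)"
    "\<forall>R \<in> Pow (verts n) - N. accepts B (mono_edges R) \<longrightarrow> f2 (mono_edges R)"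
    by (elim exE conjE) (rule that)
  from gate[OF A(1) B(1)] obtain C P' N' where C: "approximator C"
    "P' \<subseteq> perms" "card P' \<le> bound\<^sup>2 * fact (n - Suc r)"
    "N' \<subseteq> Pow (verts n)" "real (card N') \<le> 2 * bound\<^sup>2 * err"
    "\<forall>\<sigma> \<in> perms - P'. c (accepts A (perm_edges n \<sigma>)) (accepts B (perm_edges n \<sigma>)) \<longrightarrow>
          accepts C (perm_edges n \<sigma>)"
    "\<forall>R \<in> Pow (verts n) - N'. accepts C (mono_edges R) \<longrightarrow>
          c (accepts A (mono_edges R)) (accepts B (mono_edges R))"
    by (elim exE conjE) (rule that)
  have new: "\<exists>A. approximator A
      \<and> (\<forall>\<sigma> \<in> perms - (P \<union> P'). f (perm_edges n \<sigma>) \<longrightarrow> accepts A (perm_edges n \<sigma>))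
      \<and> (\<forall>R \<in> Pow (verts n) - (N \<union> N'). accepts A (mono_edges R) \<longrightarrow> f (mono_edges R))"
    if f: "f \<in> insert (\<lambda>E. c (f1 E) (f2 E)) G" for f
  proof (cases "f \<in> G")
    case True
    from bspec[OF appr this] obtain A where "approximator A"
      "\<forall>\<sigma> \<in> perms - P. f (perm_edges n \<sigma>) \<longrightarrow> accepts A (perm_edges n \<sigma>)"
      "\<forall>R \<in> Pow (verts n) - N. accepts A (mono_edges R) \<longrightarrow> f (mono_edges R)"
      by (elim exE conjE) (rule that)
    then show ?thesis by (intro exI[of _ A]) blast
  next
    case False
    then have f: "f = (\<lambda>E. c (f1 E) (f2 E))" using that by simp
    show ?thesis unfolding f
    proof (intro exI[of _ C] conjI ballI impI)
      fix \<sigma> assume \<sigma>: "\<sigma> \<in> perms - (P \<union> P')" and c: "c (f1 (perm_edges n \<sigma>)) (f2 (perm_edges n \<sigma>))"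
      show "accepts C (perm_edges n \<sigma>)"
      proof (rule C(6)[rule_format])
        show "c (accepts A (perm_edges n \<sigma>)) (accepts B (perm_edges n \<sigma>))"
          by (rule mono[OF c]) (use A(2) B(2) \<sigma> in blast)+
      qed (use \<sigma> in blast)
    next
      fix R assume R: "R \<in> Pow (verts n) - (N \<union> N')" and c: "accepts C (mono_edges R)"
      have "c (accepts A (mono_edges R)) (accepts B (mono_edges R))"
        using R by (intro C(7)[rule_format] c) blast
      then show "c (f1 (mono_edges R)) (f2 (mono_edges R))"
        by (rule mono) (use A(3) B(3) R in blast)+
    qed (rule C(1))
  qed
  have cP: "card (P \<union> P') \<le> (g + 1) * (bound\<^sup>2 * fact (n - Suc r))"
    using card_Un_le[of P P'] PN(2) C(3) by simp
  have "real (card (N \<union> N')) \<le> real (card N) + real (card N')"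
    using card_Un_le[of N N'] by linarith
  then have cN: "real (card (N \<union> N')) \<le> real (g + 1) * (2 * bound\<^sup>2 * err)"
    using PN(4) C(5) by (simp add: algebra_simps)
  show ?thesis unfolding approximable_def
    by (rule exI[of _ "P \<union> P'"], rule exI[of _ "N \<union> N'"])
      (intro conjI ballI; (rule cP cN new; assumption?)?; use PN C in blast)
qed

lemma approximable_disj:
  assumes "approximable g G" "f1 \<in> G" "f2 \<in> G"
  shows "approximable (g + 1) (insert (\<lambda>E. f1 E \<or> f2 E) G)"
proof (rule approximable_gate[OF assms, where c = "(\<or>)"], goal_cases)
  case (1 A B)
  obtain C N where "approximator C" "\<forall>E. accepts A E \<or> accepts B E \<longrightarrow> accepts C E"
    "N \<subseteq> Pow (verts n)" "real (card N) \<le> 2 * bound\<^sup>2 * err"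
    "\<forall>R \<in> Pow (verts n) - N. accepts C (mono_edges R) \<longrightarrow>
        accepts A (mono_edges R) \<or> accepts B (mono_edges R)"
    using approximator_disj[OF 1] by (elim exE conjE) (rule that)
  then show ?case by (intro exI[of _ C] exI[of _ "{}"] exI[of _ N] conjI) simp_all
qed blast

lemma approximable_conj:
  assumes "approximable g G" "f1 \<in> G" "f2 \<in> G"
  shows "approximable (g + 1) (insert (\<lambda>E. f1 E \<and> f2 E) G)"
  by (rule approximable_gate[OF assms, where c = "(\<and>)"]) (erule (1) approximator_conj, blast)

section \<open>Gate counts of composed monotone functions\<close>

definition inputs :: "(edge set \<Rightarrow> bool) set" where
  "inputs = {\<lambda>_. True, \<lambda>_. False} \<union> {\<lambda>E. e \<in> E | e. e \<in> edges n}"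

text \<open>Constants and edge variables are represented without error, by \<open>{{}}\<close>,
  \<open>{}\<close> and \<open>{{e}}\<close>.\<close>

lemma approximable_inputs: "approximable 0 inputs"
proof -
  have "\<exists>A. approximator A \<and> (\<forall>E. accepts A E \<longleftrightarrow> f E)" if f: "f \<in> inputs" for f
  proof -
    consider "f = (\<lambda>_. True)" | "f = (\<lambda>_. False)" | e where "e \<in> edges n" "f = (\<lambda>E. e \<in> E)"
      using f unfolding inputs_def by blast
    then show ?thesis
    proof cases
      case 1
      then show ?thesis using bound_pos
        by (intro exI[of _ "{{}}"]) (auto simp: approximator_def accepts_def admissible_def matching_def)
    next
      case 2
      then show ?thesis by (intro exI[of _ "{}"]) (auto simp: approximator_def accepts_def)
    next
      case (3 e)
      then show ?thesis using bound_pos r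
        by (intro exI[of _ "{{e}}"])
          (auto simp: approximator_def accepts_def admissible_def matching_def)
    qed
  qed
  then show ?thesis unfolding approximable_def
    by (intro exI[of _ "{}"]) (simp, meson)
qed

text \<open>The number of extra gates that suffice to obtain \<open>f\<close> from \<open>G\<close>.
  Quantifying over all supersets \<open>G'\<close> makes this composable, since intermediate results
  may have been added to the available functions.\<close>

definition cost :: "nat \<Rightarrow> (edge set \<Rightarrow> bool) set \<Rightarrow> (edge set \<Rightarrow> bool) \<Rightarrow> bool" where
  "cost c G f \<longleftrightarrow> (\<forall>g G'. G \<subseteq> G' \<longrightarrow> approximable g G' \<longrightarrow> approximable (g + c) (insert f G'))"

lemma cost_mem: "f \<in> G \<Longrightarrow> cost 0 G f"
  by (auto simp: cost_def insert_absorb subsetD)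

lemma cost_disj:
  assumes "cost a G f1" "cost b G f2"
  shows "cost (a + b + 1) G (\<lambda>E. f1 E \<or> f2 E)"
  unfolding cost_def
proof (intro allI impI)
  fix g G' assume G': "G \<subseteq> G'" "approximable g G'"
  have "approximable (g + a) (insert f1 G')"
    using assms(1) G' unfolding cost_def by blast
  then have "approximable (g + a + b) (insert f2 (insert f1 G'))"
    using assms(2) G'(1) unfolding cost_def by (meson subset_insertI2)
  then have "approximable (g + a + b + 1) (insert (\<lambda>E. f1 E \<or> f2 E) (insert f2 (insert f1 G')))"
    by (rule approximable_disj) simp_all
  then show "approximable (g + (a + b + 1)) (insert (\<lambda>E. f1 E \<or> f2 E) G')"
    unfolding add.assoc[symmetric] by (rule approximable_subset) blast
qed

lemma cost_conj:
  assumes "cost a G f1" "cost b G f2"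
  shows "cost (a + b + 1) G (\<lambda>E. f1 E \<and> f2 E)"
  unfolding cost_def
proof (intro allI impI)
  fix g G' assume G': "G \<subseteq> G'" "approximable g G'"
  have "approximable (g + a) (insert f1 G')"
    using assms(1) G' unfolding cost_def by blast
  then have "approximable (g + a + b) (insert f2 (insert f1 G'))"
    using assms(2) G'(1) unfolding cost_def by (meson subset_insertI2)
  then have "approximable (g + a + b + 1) (insert (\<lambda>E. f1 E \<and> f2 E) (insert f2 (insert f1 G')))"
    by (rule approximable_conj) simp_all
  then show "approximable (g + (a + b + 1)) (insert (\<lambda>E. f1 E \<and> f2 E) G')"
    unfolding add.assoc[symmetric] by (rule approximable_subset) blast
qed

text \<open>One gate per index joins it to the rest; the empty disjunction is a constant input and
  costs nothing.\<close>

lemma cost_Bex: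
  assumes "finite I" "inputs \<subseteq> G" "\<And>i. i \<in> I \<Longrightarrow> cost c G (f i)"
  shows "cost (card I * (c + 1)) G (\<lambda>E. \<exists>i\<in>I. f i E)"
  using assms(1,3)
proof (induction I rule: finite_induct)
  case empty
  have "(\<lambda>_. False) \<in> G" using assms(2) by (auto simp: inputs_def)
  then show ?case using cost_mem by simp
next
  case (insert i I)
  then show ?case using cost_disj[of c G "f i" "card I * (c + 1)" "\<lambda>E. \<exists>i\<in>I. f i E"]
    by (simp add: algebra_simps)
qed

lemma cost_Ball:
  assumes "finite I" "inputs \<subseteq> G" "\<And>i. i \<in> I \<Longrightarrow> cost c G (f i)"
  shows "cost (card I * (c + 1)) G (\<lambda>E. \<forall>i\<in>I. f i E)"
  using assms(1,3)
proof (induction I rule: finite_induct)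
  case empty
  have "(\<lambda>_. True) \<in> G" using assms(2) by (auto simp: inputs_def)
  then show ?case using cost_mem by simp
next
  case (insert i I)
  then show ?case using cost_conj[of c G "f i" "card I * (c + 1)" "\<lambda>E. \<forall>i\<in>I. f i E"]
    by (simp add: algebra_simps)
qed

lemma approximable_mono:
  assumes "approximable g G" "g \<le> g'"
  shows "approximable g' G"
proof -
  have 1: "g * (bound\<^sup>2 * fact (n - Suc r)) \<le> g' * (bound\<^sup>2 * fact (n - Suc r))"
    using assms(2) by simp
  have 2: "real g * (2 * bound\<^sup>2 * err) \<le> real g' * (2 * bound\<^sup>2 * err)"
    using assms(2) err_nonneg by (intro mult_right_mono) auto
  show ?thesis using assms(1) unfolding approximable_def
    by (elim exE conjE) (rule exI, rule exI, intro conjI, assumption, erule order.trans[OF _ 1],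
      assumption, erule order.trans[OF _ 2], assumption)
qed

lemma cost_mono: "cost c G f \<Longrightarrow> c \<le> c' \<Longrightarrow> cost c' G f"
  unfolding cost_def by (meson add_left_mono approximable_mono)

text \<open>All members of the family stay available, so one layer of a computation is paid for once
  and shared by the next.\<close>

lemma approximable_family:
  assumes "finite I" "approximable g G" "\<And>i. i \<in> I \<Longrightarrow> cost c G (f i)"
  shows "approximable (g + card I * c) (G \<union> f ` I)"
  using assms(1,3)
proof (induction I rule: finite_induct)
  case (insert i I)
  have "approximable (g + card I * c) (G \<union> f ` I)" using insert by simp
  then have "approximable (g + card I * c + c) (insert (f i) (G \<union> f ` I))"
    using insert.prems[of i] unfolding cost_def by blast
  then show ?case using insert.hyps by (simp add: algebra_simps)
qed (use assms(2) in simp)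

text \<open>An empty approximator errs on all \<open>fact n\<close> permutations. Otherwise it has a
  member \<open>M\<close> with at most \<open>r\<close> edges, and it accepts every colour class
  that avoids the endpoints of \<open>M\<close>; at least \<open>2 * n - 2 * r\<close> vertices
  remain, and every odd class among them is an error.\<close>

lemma approximable_lower_bound:
  assumes "approximable g {f}"
    and "\<And>\<sigma>. \<sigma> permutes {..<n} \<Longrightarrow> f (perm_edges n \<sigma>)"
    and "\<And>R. R \<subseteq> verts n \<Longrightarrow> odd (card R) \<Longrightarrow> \<not> f (mono_edges R)"
  shows "fact n \<le> g * (bound\<^sup>2 * fact (n - Suc r))
    \<or> 2 ^ (2 * n - 2 * r - 1) \<le> g * (2 * bound\<^sup>2 * err)"
proof -
  obtain P N A where P: "P \<subseteq> perms" "card P \<le> g * (bound\<^sup>2 * fact (n - Suc r))"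
    and N: "N \<subseteq> Pow (verts n)" "real (card N) \<le> g * (2 * bound\<^sup>2 * err)"
    and A: "approximator A"
        "\<And>\<sigma>. \<sigma> \<in> perms - P \<Longrightarrow> f (perm_edges n \<sigma>) \<Longrightarrow> accepts A (perm_edges n \<sigma>)"
        "\<And>R. R \<in> Pow (verts n) - N \<Longrightarrow> accepts A (mono_edges R) \<Longrightarrow> f (mono_edges R)"
    using assms(1) unfolding approximable_def by auto
  show ?thesis
  proof (cases "A = {}")
    case True
    then have "perms \<subseteq> P" using A(2) assms(2) by (force simp: accepts_def)
    then have "P = perms" using P(1) by blast
    then show ?thesis using P(2) card_permutations[of "{..<n}" n] by simp
  next
    case False
    then obtain M where M: "M \<in> A" by blast
    then have fin: "finite M" "card M \<le> r" "M \<subseteq> edges n"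
      using A(1) by (auto simp: approximator_def admissible_def matching_def)
    let ?S = "verts n - ends M"
    let ?O = "{R. R \<subseteq> ?S \<and> odd (card R)}"
    have "2 * n - 2 * r \<le> card ?S"
      using diff_card_le_card_Diff[OF finite_ends[OF fin(1)], of "verts n"] card_ends[OF fin(1)]
        card_verts[of n] fin(2) by linarith
    moreover from this have "?S \<noteq> {}" using r by (intro notI) simp
    ultimately have "2 ^ (2 * n - 2 * r - 1) \<le> (2 :: nat) ^ (card ?S - 1)" "finite ?S" "?S \<noteq> {}"
      by (auto intro: power_increasing)
    then have "2 ^ (2 * n - 2 * r - 1) \<le> card ?O"
      using card_odd_subsets[of ?S] by linarith
    moreover have "?O \<subseteq> N"
    proof
      fix R assume R: "R \<in> ?O"
      \<comment> \<open>A class avoiding the endpoints of \<open>M\<close> gives them all the same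
        colour, exactly as the empty class does.\<close>
      have "M \<subseteq> mono_edges {}" by (auto simp: mono_edges_def)
      moreover have "R \<inter> ends M = {} \<inter> ends M" using R by blast
      ultimately have "M \<subseteq> mono_edges R" using mono_edges_cong by blast
      then have "accepts A (mono_edges R)" using M by (auto simp: accepts_def)
      moreover have "R \<subseteq> verts n" "odd (card R)" using R by auto
      ultimately show "R \<in> N" using A(3)[of R] assms(3)[of R] by blast
    qed
    then have "card ?O \<le> card N"
      using N(1) by (intro card_mono) (auto intro: finite_subset)
    ultimately have "2 ^ (2 * n - 2 * r - 1) \<le> card N" by linarith
    then have "2 ^ (2 * n - 2 * r - 1) \<le> real (card N)"
      by (metis of_nat_le_iff of_nat_numeral of_nat_power)
    then show ?thesis using N(2) by linarith
  qed
qed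

end


section \<open>Unit propagation as a monotone computation\<close>

fun neg :: "'v literal \<Rightarrow> 'v literal" where
  "neg (Pos v) = Neg v"
| "neg (Neg v) = Pos v"

definition true_lits :: "'v passign \<Rightarrow> 'v literal set" where
  "true_lits \<phi> = {x. lit_val \<phi> x = Some True}"

text \<open>Derived literals are collected in a set, which may contain complementary literals,
  instead of being applied as assignments. This makes each round monotone in the set before
  it.\<close>

primrec up :: "'v clause_set \<Rightarrow> 'v literal set \<Rightarrow> nat \<Rightarrow> 'v literal set" where
  "up F X 0 = X"
| "up F X (Suc t) = up F X t \<union> {x. \<exists>C\<in>F. x \<in> C \<and> (\<forall>y\<in>C - {x}. neg y \<in> up F X t)}"

definition up_closed :: "'v clause_set \<Rightarrow> 'v literal set \<Rightarrow> bool" where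
  "up_closed F Y \<longleftrightarrow> (\<forall>C\<in>F. \<forall>x\<in>C. (\<forall>y\<in>C - {x}. neg y \<in> Y) \<longrightarrow> x \<in> Y)"

definition up_refutes :: "'v clause_set \<Rightarrow> 'v literal set \<Rightarrow> bool" where
  "up_refutes F Y \<longleftrightarrow> (\<exists>C\<in>F. \<forall>y\<in>C. neg y \<in> Y)"

lemma neg_true_lits: "neg x \<in> true_lits \<phi> \<longleftrightarrow> lit_val \<phi> x = Some False"
  by (cases x) (auto simp: true_lits_def)

lemma up_subset: "up F X t \<subseteq> X \<union> \<Union>F"
  by (induction t) auto

lemma up_mono: "mono (up F X)"
  by (rule incseq_SucI) auto

lemma up_superset: "X \<subseteq> up F X t"
  by (induction t) auto

text \<open>Within the literals of \<open>F\<close> the rounds grow strictly until they stop for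
  good, so \<open>card (\<Union>F)\<close> rounds suffice.\<close>

lemma up_closed_up:
  assumes "finite (\<Union>F)"
  shows "up_closed F (up F X (card (\<Union>F)))"
proof -
  define f where "f t = up F X t \<inter> \<Union>F" for t
  have up: "up F X t = X \<union> f t" for t
    using up_subset[of F X t] up_superset[of X F t] by (auto simp: f_def)
  have "mono f" using up_mono[of F X] by (fastforce simp: f_def mono_def)
  moreover have "\<forall>t. f t = f (Suc t) \<longrightarrow> f (Suc t) = f (Suc (Suc t))"
  proof (intro allI impI)
    fix t assume "f t = f (Suc t)"
    then have "up F X t = up F X (Suc t)" by (simp only: up)
    then have "up F X (Suc t) = up F X (Suc (Suc t))" unfolding up.simps by presburger
    then show "f (Suc t) = f (Suc (Suc t))" by (simp only: f_def)
  qed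
  moreover have "finite (range f)"
    by (rule finite_subset[of _ "Pow (\<Union>F)"]) (use assms in \<open>auto simp: f_def\<close>)
  ultimately have "\<exists>N. (\<forall>n\<le>N. \<forall>m\<le>N. m < n \<longrightarrow> f m \<subset> f n) \<and> (\<forall>n\<ge>N. f N = f n)"
    by (intro finite_mono_remains_stable_implies_strict_prefix)
  then have "f (card (\<Union>F)) = (\<Union>t. f t)"
    using assms by (intro finite_mono_strict_prefix_implies_finite_fixpoint) (auto simp only: f_def)
  then have "f (Suc (card (\<Union>F))) \<subseteq> f (card (\<Union>F))" by blast
  then have "up F X (Suc (card (\<Union>F))) \<subseteq> up F X (card (\<Union>F))" unfolding up by blast
  then show ?thesis unfolding up_closed_def up.simps by blast
qed

lemma apply_empty_iff: "\<phi> \<star> F = {} \<longleftrightarrow> (\<forall>C\<in>F. \<exists>x\<in>C. lit_val \<phi> x = Some True)"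
  by (auto simp: apply_assign_def)

lemma bot_in_apply_iff: "{} \<in> \<phi> \<star> F \<longleftrightarrow> (\<exists>C\<in>F. \<forall>x\<in>C. lit_val \<phi> x = Some False)"
proof
  assume "{} \<in> \<phi> \<star> F"
  then obtain C where "C \<in> F" "{} = {x \<in> C. lit_val \<phi> x \<noteq> Some False}"
    unfolding apply_assign_def by blast
  then show "\<exists>C\<in>F. \<forall>x\<in>C. lit_val \<phi> x = Some False" by blast
next
  assume "\<exists>C\<in>F. \<forall>x\<in>C. lit_val \<phi> x = Some False"
  then obtain C where "C \<in> F" "\<forall>x\<in>C. lit_val \<phi> x = Some False" by blast
  then show "{} \<in> \<phi> \<star> F"
    unfolding apply_assign_def by (intro image_eqI[of _ _ C]) auto
qed

lemma red_0_refuted: "red 0 F = {{}} \<longleftrightarrow> {} \<in> F"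
  by auto

lemma lit_val_set_lit:
  "lit_val (set_lit x False) y = Some False \<longleftrightarrow> y = x"
  "lit_val (set_lit x True) y = Some True \<longleftrightarrow> y = x"
  by (cases x; cases y; auto)+

text \<open>Along the run of the reduction, \<phi> accumulates the forced literals, all of which lie
  in \<open>Y\<close>. The clause falsified at the end therefore has all its complements in
  \<open>Y\<close>.\<close>

lemma up_refutes_reduction:
  fixes F :: "'v clause_set"
  assumes "reduction (red 0) G {{}}" "G = \<phi> \<star> F" "true_lits \<phi> \<subseteq> Y" "up_closed F Y"
  shows "up_refutes F Y"
  using assms
proof (induction G "{{}} :: 'v clause_set" arbitrary: \<phi> rule: reduction.induct)
  case (refuted G)
  then obtain C where "C \<in> F" "\<forall>x\<in>C. lit_val \<phi> x = Some False"
    unfolding red_0_refuted using bot_in_apply_iff by metis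
  then show ?case using refuted.prems(2) neg_true_lits unfolding up_refutes_def by blast
next
  case (forced G x)
  have no: "\<not> (\<exists>C\<in>F. \<forall>y\<in>C. lit_val \<phi> y = Some False)"
    using forced.hyps(1) forced.prems(1) unfolding red_0_refuted by (simp add: bot_in_apply_iff)
  obtain C where C: "C \<in> F" "\<forall>y\<in>C. lit_val (set_lit x False ++ \<phi>) y = Some False"
    using forced.hyps(2) forced.prems(1) unfolding red_0_refuted
    by (auto simp: apply_apply bot_in_apply_iff)
  \<comment> \<open>\<open>C\<close> becomes false only when \<open>x\<close> does, so under \<phi>
    it is reduced to the unit clause of \<open>x\<close>.\<close>
  have *: "y = x \<or> lit_val \<phi> y = Some False" if "y \<in> C" for y
    using bspec[OF C(2) that] lit_val_set_lit(1)[of x y]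
    by (cases "lit_val \<phi> y") (auto simp: lit_val_add)
  then have "x \<in> C" using no C(1) by blast
  moreover have "\<forall>y\<in>C - {x}. neg y \<in> Y"
    using * forced.prems(2) neg_true_lits by blast
  ultimately have x: "x \<in> Y"
    using forced.prems(3) C(1) unfolding up_closed_def by blast
  show ?case
  proof (rule forced.hyps(4))
    show "set_lit x True \<star> G = (set_lit x True ++ \<phi>) \<star> F"
      using forced.prems(1) by (simp add: apply_apply)
    show "true_lits (set_lit x True ++ \<phi>) \<subseteq> Y"
      using forced.prems(2) x
      by (auto simp: true_lits_def lit_val_add lit_val_set_lit split: option.splits)
  qed (rule forced.prems)
next
  case irreducible
  then show ?case unfolding red_0_refuted by blast
qed

lemma up_refutes_complete:
  assumes "is_clause_set F" "red 1 (\<phi> \<star> F) = {{}}" "true_lits \<phi> \<subseteq> Y" "up_closed F Y"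
  shows "up_refutes F Y"
proof (rule up_refutes_reduction[OF _ refl assms(3,4)])
  show "reduction (red 0) (\<phi> \<star> F) {{}}"
    using assms(2) red_Suc_iff[OF is_clause_set_apply[OF assms(1)], of 0 \<phi> "{{}}"] by simp
qed

text \<open>If \<tau> satisfies \<open>F\<close> and makes \<open>X\<close> true, it makes each
  derived literal true, because it satisfies the clause that yields the literal. No clause can then
  be falsified.\<close>

lemma up_refutes_sound:
  assumes "\<tau> \<star> F = {}" "X \<subseteq> true_lits \<tau>"
  shows "\<not> up_refutes F (up F X t)"
proof -
  have sat: "\<exists>x\<in>C. lit_val \<tau> x = Some True" if "C \<in> F" for C
    using assms(1) that by (simp add: apply_empty_iff)
  have up: "up F X t \<subseteq> true_lits \<tau>"
  proof (induction t)
    case (Suc t)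
    have "x \<in> true_lits \<tau>" if x: "C \<in> F" "x \<in> C" "\<forall>y\<in>C - {x}. neg y \<in> up F X t" for x C
    proof -
      obtain y where y: "y \<in> C" "lit_val \<tau> y = Some True" using sat[OF x(1)] by blast
      have "y = x" using y x(3) Suc.IH neg_true_lits[of y \<tau>] by auto
      then show ?thesis using y by (simp add: true_lits_def)
    qed
    then show ?case using Suc.IH by auto
  qed (use assms(2) in simp)
  show ?thesis
  proof
    assume "up_refutes F (up F X t)"
    then obtain C where C: "C \<in> F" "\<forall>y\<in>C. neg y \<in> true_lits \<tau>"
      using up unfolding up_refutes_def by blast
    then show False using sat[OF C(1)] neg_true_lits[of _ \<tau>] by force
  qed
qed

text \<open>The minimum in \<open>rel_hd\<close> is attained by \<open>ex_hd_bound\<close>, and a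
  refutation at level 0 is also one at level 1.\<close>

lemma red_1_if_rel_hd:
  assumes "is_clause_set F" "rel_hd V F \<le> 1" "finite (dom \<phi>)" "dom \<phi> \<subseteq> V"
    "\<not> satisfiable (\<phi> \<star> F)"
  shows "red 1 (\<phi> \<star> F) = {{}}"
proof -
  have *: "red (rel_hd V F) (\<phi> \<star> F) = {{}}"
    using LeastI_ex[OF ex_hd_bound[OF assms(1), of V]] assms(3-5) unfolding rel_hd_def by blast
  consider "rel_hd V F = 0" | "rel_hd V F = 1" using assms(2) by linarith
  then show ?thesis
  proof cases
    case 1
    show ?thesis
      using red_Suc_refuted[OF is_clause_set_apply[OF assms(1)] *] unfolding 1 One_nat_def .
  next
    case 2
    then show ?thesis using * by (simp only:)
  qed
qed

text \<open>The empty clause contributes no literal, which accounts for the extra 1 in the bound on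
  \<open>card F\<close>.\<close>

lemma clause_set_sizes:
  assumes "is_clause_set F"
  shows "finite (\<Union>F)" "card (\<Union>F) \<le> num_lits F" "card F \<le> num_lits F + 1"
    "\<And>C. C \<in> F \<Longrightarrow> card C \<le> num_lits F"
proof -
  have fin: "finite F" "\<And>C. C \<in> F \<Longrightarrow> finite C"
    using assms by (auto simp: is_clause_set_def is_clause_def)
  show "finite (\<Union>F)" using fin by blast
  show "card (\<Union>F) \<le> num_lits F"
    unfolding num_lits_def using fin by (intro card_Union_le_sum_card)
  show "card C \<le> num_lits F" if "C \<in> F" for C
    unfolding num_lits_def using fin(1) that by (intro member_le_sum) auto
  have "card (F - {{}}) = (\<Sum>C\<in>F - {{}}. 1)" by simp
  also have "\<dots> \<le> (\<Sum>C\<in>F - {{}}. card C)"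
    using fin by (intro sum_mono) (simp add: Suc_le_eq card_gt_0_iff)
  also have "\<dots> \<le> num_lits F"
    unfolding num_lits_def using fin(1) by (intro sum_mono2) auto
  finally show "card F \<le> num_lits F + 1"
    using card_Diff1_le[of F "{}"] by (cases "{} \<in> F") (auto simp: fin)
qed

context approximation
begin

text \<open>
  Non-derivability is monotone in the set of available edges, which turns the layers of unit
  propagation into the layers of a monotone circuit.
\<close>

lemma approximable_up:
  assumes F: "is_clause_set F" and X: "\<And>x. (\<lambda>E. x \<notin> X E) \<in> inputs"
  shows "approximable (2 * (num_lits F + 1) ^ 4)
    {\<lambda>E. \<not> up_refutes F (up F (X E) (card (\<Union>F)))}"
proof -
  define s where "s = num_lits F + 1"
  define U where "U t x = (\<lambda>E. x \<notin> up F (X E) t)" for t x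
  have fin: "finite F" "\<And>C. C \<in> F \<Longrightarrow> finite C"
    using F by (auto simp: is_clause_set_def is_clause_def)
  note sizes = clause_set_sizes[OF F]
  have clause: "cost s (inputs \<union> range (U t)) (\<lambda>E. \<exists>y\<in>D. U t (neg y) E)"
    if "C \<in> F" "D \<subseteq> C" for C D t
  proof -
    have "finite D" "card D \<le> s"
      using that fin card_mono[of C D] sizes(4)[of C] by (auto simp: s_def intro: finite_subset)
    then show ?thesis
      using cost_Bex[of D "inputs \<union> range (U t)" 0 "\<lambda>y. U t (neg y)"]
      by (auto intro: cost_mono cost_mem)
  qed
  have clauses: "cost (s * (s + 1)) (inputs \<union> range (U t))
      (\<lambda>E. \<forall>C\<in>F'. \<exists>y\<in>D C. U t (neg y) E)" if "F' \<subseteq> F" "\<And>C. C \<in> F' \<Longrightarrow> D C \<subseteq> C" for F' D t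
  proof -
    have "finite F'" "card F' \<le> s"
      using that fin card_mono[of F F'] sizes(3) by (auto simp: s_def intro: finite_subset)
    moreover from this have "cost (card F' * (s + 1)) (inputs \<union> range (U t))
      (\<lambda>E. \<forall>C\<in>F'. \<exists>y\<in>D C. U t (neg y) E)"
      using that by (intro cost_Ball) (auto intro!: clause)
    ultimately show ?thesis by (meson cost_mono mult_le_mono1)
  qed
  have step: "cost (s * (s + 1) + 1) (inputs \<union> range (U t)) (U (Suc t) x)" for t x
  proof -
    \<comment> \<open>A literal stays underived iff it was underived and each clause containing it
      has another literal whose complement is underived: a conjunction of disjunctions over the
      previous layer.\<close>
    have "U (Suc t) x = (\<lambda>E. U t x E \<and> (\<forall>C\<in>{C \<in> F. x \<in> C}. \<exists>y\<in>C - {x}. U t (neg y) E))"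
      by (auto simp: U_def fun_eq_iff)
    then show ?thesis
      using cost_conj[OF cost_mem[of "U t x"] clauses[of "{C \<in> F. x \<in> C}" "\<lambda>C. C - {x}" t]]
      by auto
  qed
  have layers: "approximable (t * (s * (s * (s + 1) + 1))) (inputs \<union> range (U t))" for t
  proof (induction t)
    case 0
    have "range (U 0) \<subseteq> inputs" using X by (auto simp: U_def)
    then show ?case using approximable_inputs approximable_subset[of 0 inputs] by simp
  next
    case (Suc t)
    have "approximable (t * (s * (s * (s + 1) + 1)) + card (\<Union>F) * (s * (s + 1) + 1))
      (inputs \<union> range (U t) \<union> U (Suc t) ` \<Union>F)"
      using Suc.IH sizes(1) step by (intro approximable_family)
    \<comment> \<open>Literals outside \<open>F\<close> never change their status, so a layer adds
      at most \<open>card (\<Union>F)\<close> functions even over infinitely many variables.\<close>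
    moreover have "U (Suc t) x = U t x" if "x \<notin> \<Union>F" for x
      using that by (auto simp: U_def)
    then have "range (U (Suc t)) \<subseteq> range (U t) \<union> U (Suc t) ` \<Union>F" by blast
    ultimately have "approximable (t * (s * (s * (s + 1) + 1)) + card (\<Union>F) * (s * (s + 1) + 1))
      (inputs \<union> range (U (Suc t)))"
      by (elim approximable_subset) blast
    moreover have "card (\<Union>F) * (s * (s + 1) + 1) \<le> s * (s * (s + 1) + 1)"
      using sizes(2) by (intro mult_le_mono1) (simp add: s_def)
    ultimately show ?case by (elim approximable_mono) simp
  qed
  let ?T = "card (\<Union>F)"
  have "(\<lambda>E. \<not> up_refutes F (up F (X E) ?T)) = (\<lambda>E. \<forall>C\<in>F. \<exists>y\<in>C. U ?T (neg y) E)"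
    by (auto simp: U_def up_refutes_def)
  then have "cost (s * (s + 1)) (inputs \<union> range (U ?T)) (\<lambda>E. \<not> up_refutes F (up F (X E) ?T))"
    using clauses[of F "\<lambda>C. C" ?T] by simp
  then have "approximable (?T * (s * (s * (s + 1) + 1)) + s * (s + 1))
      (insert (\<lambda>E. \<not> up_refutes F (up F (X E) ?T)) (inputs \<union> range (U ?T)))"
    using layers[of ?T] unfolding cost_def by blast
  then have "approximable (?T * (s * (s * (s + 1) + 1)) + s * (s + 1))
      {\<lambda>E. \<not> up_refutes F (up F (X E) ?T)}"
    by (rule approximable_subset) blast
  moreover have "?T * (s * (s * (s + 1) + 1)) + s * (s + 1) \<le> 2 * s ^ 4"
  proof -
    \<comment> \<open>With \<open>m = s - 1\<close>, the total is at most
      \<open>s ^ 4 + s\<^sup>2\<close>.\<close>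
    obtain m where m: "s = Suc m" "?T \<le> m" using sizes(2) by (simp add: s_def)
    have "?T * (s * (s * (s + 1) + 1)) \<le> m * (s * (s * (s + 1) + 1))"
      using m(2) by (rule mult_le_mono1)
    also have "\<dots> + s * (s + 1) \<le> 2 * s ^ 4"
      unfolding m(1) by (simp add: algebra_simps eval_nat_numeral)
    finally show ?thesis by simp
  qed
  ultimately show ?thesis unfolding s_def by (rule approximable_mono)
qed

end


section \<open>The odd factor system\<close>

definition star :: "nat \<Rightarrow> vertex \<Rightarrow> edge set" where
  "star n v = {e \<in> edges n. v \<in> ends {e}}"

lemma ends_single: "ends {(i, j)} = {Inl i, Inr j}"
  by (auto simp: ends_def)

lemma finite_star: "finite (star n v)"
  by (rule finite_subset[of _ "edges n"]) (auto simp: star_def)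

lemma card_star_le: "card (star n v) \<le> n"
proof (cases v)
  case (Inl i)
  then have "star n v \<subseteq> {i} \<times> {..<n}" by (auto simp: star_def ends_single)
  from card_mono[OF _ this] show ?thesis by (simp add: card_cartesian_product)
next
  case (Inr j)
  then have "star n v \<subseteq> {..<n} \<times> {j}" by (auto simp: star_def ends_single)
  from card_mono[OF _ this] show ?thesis by (simp add: card_cartesian_product)
qed

lemma card_star_perm_edges:
  assumes "\<sigma> permutes {..<n}" "v \<in> verts n"
  shows "card (star n v \<inter> perm_edges n \<sigma>) = 1"
proof -
  have "\<exists>e. star n v \<inter> perm_edges n \<sigma> = {e}"
  proof (cases v)
    case (Inl i)
    moreover have "i < n" "\<sigma> i < n"
      using assms(2) Inl permutes_in_image[OF assms(1), of i] by auto
    ultimately have "star n v \<inter> perm_edges n \<sigma> = {(i, \<sigma> i)}"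
      by (auto simp: star_def ends_single perm_edges_def)
    then show ?thesis by blast
  next
    case (Inr j)
    have j: "\<sigma> (inv \<sigma> j) = j" "inv \<sigma> j < n" "j < n"
      using assms(2) Inr permutes_inverses(1)[OF assms(1)]
        permutes_in_image[OF permutes_inv[OF assms(1)], of j] by auto
    have "(i, \<sigma> i) \<in> star n v \<longleftrightarrow> i = inv \<sigma> j" if "i < n" for i
      using that j(3) permutes_inv_eq[OF assms(1), of j i] permutes_in_image[OF assms(1), of i]
      by (simp add: Inr star_def ends_single) metis
    then have "star n v \<inter> perm_edges n \<sigma> = {(inv \<sigma> j, \<sigma> (inv \<sigma> j))}"
      using j(2) unfolding perm_edges_def by blast
    then show ?thesis by blast
  qed
  then show ?thesis by auto
qed

text \<open>
  Double counting: an edge of a monochromatic graph has zero or two endpoints of a given colour.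
\<close>

lemma even_coloured_vertex:
  assumes "R \<subseteq> verts n" "odd (card R)" "S \<subseteq> edges n" "S \<subseteq> mono_edges R"
  shows "\<exists>v\<in>R. even (card (star n v \<inter> S))"
proof (rule ccontr)
  assume "\<not> ?thesis"
  then have odd: "{v \<in> R. odd (card (star n v \<inter> S))} = R" by blast
  have fin: "finite R" "finite S" using assms by (auto intro: finite_subset)
  have "(\<Sum>v\<in>R. card {e \<in> S. v \<in> ends {e}}) = (\<Sum>e\<in>S. card {v \<in> R. v \<in> ends {e}})"
    using fin by (intro sum_multicount_gen) auto
  moreover have "star n v \<inter> S = {e \<in> S. v \<in> ends {e}}" for v
    using assms(3) by (auto simp: star_def)
  ultimately have eq: "(\<Sum>v\<in>R. card (star n v \<inter> S)) = (\<Sum>e\<in>S. card {v \<in> R. v \<in> ends {e}})"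
    by simp
  have "even (\<Sum>e\<in>S. card {v \<in> R. v \<in> ends {e}})"
  proof (rule dvd_sum)
    fix e assume "e \<in> S"
    obtain i j where e: "e = (i, j)" by (cases e)
    then have "Inl i \<in> R \<longleftrightarrow> Inr j \<in> R" using \<open>e \<in> S\<close> assms(4) by (auto simp: mono_edges_def)
    then have "{v \<in> R. v \<in> ends {e}} = (if Inl i \<in> R then {Inl i, Inr j} else {})"
      by (auto simp: e ends_single)
    then show "2 dvd card {v \<in> R. v \<in> ends {e}}" by auto
  qed
  moreover have "odd (\<Sum>v\<in>R. card (star n v \<inter> S))"
    using even_sum_iff[OF fin(1), of "\<lambda>v. card (star n v \<inter> S)"] odd assms(2) by simp
  ultimately show False using eq by simp
qed

text \<open>
  The variable \<open>h 0\<close> is set to true and makes the right-hand sides of the degree constraints equal to 1.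
\<close>

locale odd_factor_system =
  fixes h :: "nat \<Rightarrow> 'v" and n :: nat
  assumes inj_h: "inj h" and n_pos: "0 < n"
begin

text \<open>The shift by \<open>Suc\<close> keeps \<open>h 0\<close> free for the constant.\<close>

definition edge_var :: "edge \<Rightarrow> 'v" where
  "edge_var e = h (Suc (prod_encode e))"

definition degree_clause :: "vertex \<Rightarrow> 'v clause" where
  "degree_clause v = insert (Pos (h 0)) ((Pos \<circ> edge_var) ` star n v)"

definition system :: "'v clause_set" where
  "system = degree_clause ` verts n"

text \<open>Edges of \<open>E\<close> stay unassigned, so the restricted system asks for an odd
  factor inside \<open>E\<close>.\<close>

definition delete_edges :: "edge set \<Rightarrow> 'v passign" where
  "delete_edges E = (\<lambda>v. if v = h 0 then Some True
     else if v \<in> edge_var ` (edges n - E) then Some False else None)"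

definition edge_assign :: "edge set \<Rightarrow> 'v passign" where
  "edge_assign S = (\<lambda>v. if v = h 0 then Some True
     else if v \<in> edge_var ` edges n then Some (v \<in> edge_var ` S) else None)"

lemma edge_var_eq [simp]: "edge_var e = edge_var e' \<longleftrightarrow> e = e'" "edge_var e \<noteq> h 0" "h 0 \<noteq> edge_var e"
  using inj_h by (auto simp: edge_var_def inj_eq)

lemma is_clause_set_system: "is_clause_set system"
  using finite_star by (auto simp: is_clause_set_def is_clause_def system_def degree_clause_def)

lemma var_system: "var system = insert (h 0) (edge_var ` edges n)"
proof
  show "var system \<subseteq> insert (h 0) (edge_var ` edges n)"
    by (auto simp: var_def system_def degree_clause_def star_def)
  have "var_lit (Pos (h 0)) \<in> var system"
    unfolding var_def system_def degree_clause_def using n_pos by blast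
  moreover have "var_lit (Pos (edge_var (i, j))) \<in> var system" if "i < n" "j < n" for i j
  proof -
    have "(i, j) \<in> star n (Inl i)" using that by (simp add: star_def ends_single)
    then have "Pos (edge_var (i, j)) \<in> degree_clause (Inl i)" by (auto simp: degree_clause_def)
    then show ?thesis using that unfolding var_def system_def by blast
  qed
  ultimately show "insert (h 0) (edge_var ` edges n) \<subseteq> var system" by auto
qed

lemma num_lits_system: "num_lits system \<le> 2 * n * (n + 1)"
proof -
  have "card (degree_clause v) \<le> n + 1" for v
  proof -
    have "card ((Pos \<circ> edge_var) ` star n v) \<le> n"
      using card_image_le[OF finite_star] card_star_le order.trans by blast
    then show ?thesis using card_insert_le_m1[of "n + 1"] by (simp add: degree_clause_def)
  qed
  then have "num_lits system \<le> of_nat (card system) * (n + 1)"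
    unfolding num_lits_def by (intro sum_bounded_above) (auto simp: system_def)
  also have "\<dots> \<le> 2 * n * (n + 1)"
  proof -
    have "card system \<le> 2 * n"
      unfolding system_def using card_image_le[of "verts n" degree_clause] card_verts[of n] by simp
    then show ?thesis by (metis mult_le_mono1 of_nat_id)
  qed
  finally show ?thesis .
qed

section \<open>Representations of the system on the two kinds of test input\<close>

lemma xor_models_iff:
  assumes "\<alpha> (h 0) = Some True"
  shows "\<alpha> \<in> xor_models system \<longleftrightarrow> dom \<alpha> = var system \<and>
    (\<forall>v\<in>verts n. odd (card (star n v \<inter> {e \<in> edges n. \<alpha> (edge_var e) = Some True})))"
proof -
  have "card {x \<in> degree_clause v. lit_val \<alpha> x = Some True}
      = Suc (card (star n v \<inter> {e \<in> edges n. \<alpha> (edge_var e) = Some True}))" for v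
  proof -
    let ?S = "star n v \<inter> {e \<in> edges n. \<alpha> (edge_var e) = Some True}"
    have "{x \<in> degree_clause v. lit_val \<alpha> x = Some True}
        = insert (Pos (h 0)) ((Pos \<circ> edge_var) ` ?S)"
      using assms by (auto simp: degree_clause_def star_def)
    moreover have "inj_on (\<lambda>e. Pos (edge_var e)) ?S" by (auto simp: inj_on_def)
    moreover have "finite ?S" using finite_star by blast
    moreover have "Pos (h 0) \<notin> (Pos \<circ> edge_var) ` ?S" by auto
    ultimately show ?thesis by (simp add: card_image)
  qed
  then show ?thesis by (simp add: xor_models_def system_def)
qed

lemma finite_dom_delete_edges: "finite (dom (delete_edges E))" "dom (delete_edges E) \<subseteq> var system"
proof -
  show "dom (delete_edges E) \<subseteq> var system"
    by (auto simp: var_system delete_edges_def split: if_splits)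
  then show "finite (dom (delete_edges E))"
    using finite_var[OF is_clause_set_system] finite_subset by blast
qed

text \<open>A perfect matching has all degrees equal to 1, so it is a model of the system and
  extends to a model of \<open>F'\<close>, which agrees with the deletion of the other
  edges.\<close>

lemma perm_satisfiable:
  assumes "is_cnf_representation F' system" "\<sigma> permutes {..<n}"
  shows "\<exists>\<tau>. \<tau> \<star> F' = {} \<and> true_lits (delete_edges (perm_edges n \<sigma>)) \<subseteq> true_lits \<tau>"
proof -
  let ?S = "perm_edges n \<sigma>" and ?\<alpha> = "edge_assign (perm_edges n \<sigma>)"
  have sub: "?S \<subseteq> edges n" using permutes_in_image[OF assms(2)] by (auto simp: perm_edges_def)
  have "{e \<in> edges n. ?\<alpha> (edge_var e) = Some True} = ?S"
    using sub by (auto simp: edge_assign_def)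
  moreover have "dom ?\<alpha> = var system"
    by (auto simp: edge_assign_def var_system dom_def)
  ultimately have "?\<alpha> \<in> xor_models system"
    using xor_models_iff[of ?\<alpha>] card_star_perm_edges[OF assms(2)] by (simp add: edge_assign_def)
  then obtain \<tau> where \<tau>: "\<tau> \<in> cnf_models F'" "?\<alpha> = \<tau> |` var system"
    using assms(1) unfolding is_cnf_representation_def by blast
  have ext: "\<tau> v = Some b" if "delete_edges ?S v = Some b" for v b
  proof -
    have "v \<in> var system" using finite_dom_delete_edges(2)[of ?S] that by blast
    moreover have "?\<alpha> v = Some b"
      using that by (auto simp: delete_edges_def edge_assign_def split: if_splits)
    ultimately show ?thesis using \<tau>(2) by (simp add: restrict_map_def)
  qed
  have "lit_val \<tau> x = Some True" if "lit_val (delete_edges ?S) x = Some True" for x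
    using that by (cases x) (auto dest: ext)
  then show ?thesis using \<tau>(1) unfolding cnf_models_def true_lits_def by blast
qed

text \<open>A satisfying assignment would yield an odd factor inside \<open>mono_edges R\<close>,
  against \<open>even_coloured_vertex\<close>.\<close>

lemma coloured_unsatisfiable:
  assumes "is_cnf_representation F' system" "R \<subseteq> verts n" "odd (card R)"
  shows "\<not> satisfiable (delete_edges (mono_edges R) \<star> F')"
proof
  let ?\<phi> = "delete_edges (mono_edges R)"
  assume "satisfiable (?\<phi> \<star> F')"
  then obtain \<psi> where "\<psi> \<star> ?\<phi> \<star> F' = {}"
    unfolding satisfiable_def by (elim exE conjE) (rule that)
  then have \<psi>: "(\<psi> ++ ?\<phi>) \<star> F' = {}" by (simp only: apply_apply)
  \<comment> \<open>Models have domain exactly \<open>var F'\<close>: other variables are dropped,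
    and missing ones get the default \<open>False\<close>.\<close>
  define \<beta> where "\<beta> v = (if v \<in> var F' then
    (case (\<psi> ++ ?\<phi>) v of None \<Rightarrow> Some False | Some b \<Rightarrow> Some b) else None)" for v
  have "\<exists>x\<in>C. lit_val \<beta> x = Some True" if C: "C \<in> F'" for C
  proof -
    obtain x where x: "x \<in> C" "lit_val (\<psi> ++ ?\<phi>) x = Some True"
      using \<psi> C unfolding apply_empty_iff by blast
    then have "var_lit x \<in> var F'" using C by (auto simp: var_def)
    then have "lit_val \<beta> x = Some True" using x(2) by (cases x) (auto simp: \<beta>_def map_add_def split: option.splits)
    then show ?thesis using x(1) by blast
  qed
  then have "\<beta> \<star> F' = {}" unfolding apply_empty_iff by blast
  moreover have "dom \<beta> = var F'" by (auto simp: \<beta>_def dom_def split: option.splits)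
  ultimately have "\<beta> \<in> cnf_models F'" by (simp add: cnf_models_def)
  let ?\<alpha> = "\<beta> |` var system"
  have xor: "?\<alpha> \<in> xor_models system" and sub: "var system \<subseteq> var F'"
    using \<open>\<beta> \<in> cnf_models F'\<close> assms(1) unfolding is_cnf_representation_def by blast+
  have ext: "?\<alpha> v = Some b" if "?\<phi> v = Some b" for v b
  proof -
    have "v \<in> var system" using that finite_dom_delete_edges(2) by blast
    then show ?thesis using that sub by (auto simp: \<beta>_def map_add_def)
  qed
  let ?S = "{e \<in> edges n. ?\<alpha> (edge_var e) = Some True}"
  have "?S \<subseteq> mono_edges R"
  proof
    fix e assume e: "e \<in> ?S"
    show "e \<in> mono_edges R"
    proof (rule ccontr)
      assume "e \<notin> mono_edges R"
      then have "?\<phi> (edge_var e) = Some False" using e by (auto simp: delete_edges_def)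
      then show False using ext e by fastforce
    qed
  qed
  then obtain v where "v \<in> R" "even (card (star n v \<inter> ?S))"
    using even_coloured_vertex[OF assms(2,3), of ?S] by blast
  moreover have "?\<alpha> (h 0) = Some True" by (rule ext) (simp add: delete_edges_def)
  then have "\<forall>v\<in>verts n. odd (card (star n v \<inter> ?S))"
    by (rule conjunct2[OF iffD1[OF xor_models_iff xor]])
  ultimately show False using assms(2) by blast
qed

text \<open>The function "propagation does not refute \<open>F'\<close> after deleting the edges
  outside \<open>E\<close>" is true on perfect matchings by soundness, and false on graphs of odd
  colour classes by hardness at most 1. Its gate count is polynomial in \<open>num_lits F'\<close>,
  so the dichotomy for approximators applies.\<close>

lemma size_lower_bound:
  assumes rep: "is_cnf_representation F' system" "rel_hd (var system) F' \<le> 1"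
    and rk: "0 < r" "r < n" "0 < k"
  shows "fact n \<le> 2 * (num_lits F' + 1) ^ 4 * ((((2 * r * k)\<^sup>2) ^ r)\<^sup>2 * fact (n - Suc r)) \<or>
    2 ^ (2 * n - 2 * r - 1) \<le> real (2 * (num_lits F' + 1) ^ 4) *
      (real (2 * (((2 * r * k)\<^sup>2) ^ r)\<^sup>2) * (2 ^ (2 * n) * (1 - 1 / 2 ^ r) ^ k))"
proof -
  interpret approximation n r k by unfold_locales (use rk in auto)
  have F': "is_clause_set F'" using rep(1) by (simp add: is_cnf_representation_def)
  let ?X = "\<lambda>E. true_lits (delete_edges E)" and ?T = "card (\<Union>F')"
  have "(\<lambda>E. x \<notin> ?X E) \<in> inputs" for x
  proof -
    \<comment> \<open>Initially, underivedness of a literal is constant, except for the negated edge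
      variables, where it says that the edge is available.\<close>
    consider "x = Pos (h 0)" | e where "e \<in> edges n" "x = Neg (edge_var e)"
      | "x \<noteq> Pos (h 0)" "x \<notin> (Neg \<circ> edge_var) ` edges n" by auto
    then show ?thesis
    proof cases
      case 1
      then have "(\<lambda>E. x \<notin> ?X E) = (\<lambda>E. False)" by (simp add: true_lits_def delete_edges_def)
      then show ?thesis by (simp add: inputs_def)
    next
      case (2 e)
      then have "(\<lambda>E. x \<notin> ?X E) = (\<lambda>E. e \<in> E)"
        by (auto simp: true_lits_def delete_edges_def fun_eq_iff)
      then show ?thesis using 2(1) unfolding inputs_def by blast
    next
      case 3
      then have "(\<lambda>E. x \<notin> ?X E) = (\<lambda>E. True)"
        by (cases x) (auto simp: true_lits_def delete_edges_def fun_eq_iff split: if_splits)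
      then show ?thesis by (simp add: inputs_def)
    qed
  qed
  then have "approximable (2 * (num_lits F' + 1) ^ 4) {\<lambda>E. \<not> up_refutes F' (up F' (?X E) ?T)}"
    by (rule approximable_up[OF F'])
  then have "fact n \<le> 2 * (num_lits F' + 1) ^ 4 * (bound\<^sup>2 * fact (n - Suc r)) \<or>
    2 ^ (2 * n - 2 * r - 1) \<le> real (2 * (num_lits F' + 1) ^ 4) * (2 * bound\<^sup>2 * err)"
  proof (rule approximable_lower_bound)
    fix \<sigma> assume "\<sigma> permutes {..<n}"
    then show "\<not> up_refutes F' (up F' (?X (perm_edges n \<sigma>)) ?T)"
      using perm_satisfiable[OF rep(1)] up_refutes_sound by metis
  next
    fix R assume R: "R \<subseteq> verts n" "odd (card R)"
    \<comment> \<open>Relative hardness applies because \<open>delete_edges\<close> assigns only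
      variables of the system.\<close>
    have "red 1 (delete_edges (mono_edges R) \<star> F') = {{}}"
      using coloured_unsatisfiable[OF rep(1) R]
      by (rule red_1_if_rel_hd[OF F' rep(2) finite_dom_delete_edges])
    then show "\<not> \<not> up_refutes F' (up F' (?X (mono_edges R)) ?T)"
      using up_refutes_complete[OF F' _ up_superset up_closed_up] clause_set_sizes(1)[OF F'] by blast
  qed
  then show ?thesis unfolding bound_def err_def .
qed

end

section \<open>Numerical estimates and the choice of parameters\<close>

text \<open>The quotient of \<open>fact n\<close> by \<open>fact (n - m)\<close> has
  \<open>m\<close> factors, each at least \<open>n + 1 - m\<close> and hence at least
  \<open>c\<close>.\<close>

lemma power_mult_fact_le: "c + m \<le> n + 1 \<Longrightarrow> c ^ m * fact (n - m) \<le> (fact n :: nat)"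
proof (induction m)
  case (Suc m)
  have "c * fact (n - Suc m) \<le> (fact (n - m) :: nat)"
  proof (cases "c = 0")
    case False
    then have "n - m = Suc (n - Suc m)" using Suc.prems by linarith
    then have "fact (n - m) = (n - m) * (fact (n - Suc m) :: nat)" by (metis fact_Suc of_nat_id)
    moreover have "c \<le> n - m" using Suc.prems by linarith
    ultimately show ?thesis by simp
  qed simp
  then have "c ^ Suc m * fact (n - Suc m) \<le> c ^ m * fact (n - m)" by (simp add: mult.assoc)
  also have "\<dots> \<le> fact n" using Suc by simp
  finally show ?case .
qed simp

lemma one_minus_inverse_power_le: "(1 - 1 / real N) ^ N \<le> 1 / 2" if "0 < N"
proof -
  have "(1 - 1 / real N) ^ N \<le> exp (- 1 / real N) ^ N"
    using that exp_ge_add_one_self[of "- 1 / real N"] by (intro power_mono) (auto simp: field_simps)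
  also have "\<dots> = exp (- 1)" using that by (simp add: exp_of_nat_mult[symmetric])
  also have "\<dots> \<le> 1 / 2" using exp_ge_add_one_self[of 1] by (simp add: exp_minus field_simps)
  finally show ?thesis .
qed

lemma exp_beats_square: "16 \<le> r \<Longrightarrow> 16 * r\<^sup>2 < 2 ^ r" for r :: nat
proof (induction r rule: dec_induct)
  case (step r)
  have "16 * r \<le> r\<^sup>2" using step.hyps(1) by (simp add: power2_eq_square)
  moreover have "(Suc r)\<^sup>2 = r\<^sup>2 + 2 * r + 1" by (simp add: power2_eq_square)
  ultimately have "16 * (Suc r)\<^sup>2 \<le> 2 * (16 * r\<^sup>2)" using step.hyps(1) by linarith
  then show ?case using step.IH by simp
qed simp

text \<open>\<open>2 ^ a\<close> dominates the sum of the absolute coefficients; a power of two is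
  taken so that later estimates only compare exponents.\<close>

lemma poly_upper_bound:
  fixes p :: "real poly"
  shows "\<exists>a d :: nat. \<forall>x\<ge>0. poly p x \<le> 2 ^ a * (x + 1) ^ d"
proof -
  let ?s = "\<Sum>i\<le>degree p. \<bar>coeff p i\<bar>"
  obtain a where a: "?s \<le> 2 ^ a" using real_arch_pow[of 2 ?s] by (auto intro: less_imp_le)
  have "poly p x \<le> 2 ^ a * (x + 1) ^ degree p" if x: "0 \<le> x" for x
  proof -
    have "poly p x = (\<Sum>i\<le>degree p. coeff p i * x ^ i)" by (rule poly_altdef)
    also have "\<dots> \<le> (\<Sum>i\<le>degree p. \<bar>coeff p i\<bar> * (x + 1) ^ degree p)"
    proof (rule sum_mono)
      fix i assume i: "i \<in> {..degree p}"
      have "x ^ i \<le> (x + 1) ^ i" using x by (intro power_mono) auto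
      also have "\<dots> \<le> (x + 1) ^ degree p" using x i by (intro power_increasing) auto
      finally show "coeff p i * x ^ i \<le> \<bar>coeff p i\<bar> * (x + 1) ^ degree p"
        using x by (intro mult_mono) auto
    qed
    also have "\<dots> = ?s * (x + 1) ^ degree p" by (rule sum_distrib_right[symmetric])
    also have "\<dots> \<le> 2 ^ a * (x + 1) ^ degree p" using a x by (intro mult_right_mono) auto
    finally show ?thesis .
  qed
  then show ?thesis by blast
qed

lemma gates_too_few:
  fixes g r :: nat
  assumes r: "16 \<le> r" and g: "g \<le> 2 ^ (r\<^sup>2)"
  defines "n \<equiv> 2 ^ (14 * r)" and "k \<equiv> 2 ^ r * 2 ^ r"
  shows "g * ((((2 * r * k)\<^sup>2) ^ r)\<^sup>2 * fact (n - Suc r)) < fact n"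
    and "real g * (real (2 * (((2 * r * k)\<^sup>2) ^ r)\<^sup>2) * (2 ^ (2 * n) * (1 - 1 / 2 ^ r) ^ k))
      < 2 ^ (2 * n - 2 * r - 1)"
proof -
  let ?L = "(((2 * r * k)\<^sup>2) ^ r)\<^sup>2"
  have r2: "16 * r\<^sup>2 < 2 ^ r" using r by (rule exp_beats_square)
  have rr: "16 * r \<le> r\<^sup>2" using r by (simp add: power2_eq_square)
  have "2 * r \<le> 2 ^ r" using r2 rr by linarith
  then have "2 * r * k \<le> 2 ^ r * k" by (rule mult_le_mono1)
  also have "\<dots> = 2 ^ (3 * r)" by (simp add: k_def flip: power_add)
  finally have "2 * r * k \<le> 2 ^ (3 * r)" .
  then have "?L \<le> (((2 ^ (3 * r))\<^sup>2) ^ r)\<^sup>2" by (intro power_mono) auto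
  also have "\<dots> = 2 ^ (3 * r * 2 * r * 2)" by (simp only: power_mult)
  also have "3 * r * 2 * r * 2 = 12 * r\<^sup>2" by (simp add: power2_eq_square)
  finally have "g * ?L \<le> 2 ^ (r\<^sup>2) * 2 ^ (12 * r\<^sup>2)" using g by (rule mult_le_mono[rotated])
  then have gL: "g * ?L \<le> 2 ^ (13 * r\<^sup>2)" by (simp flip: power_add)
  have rn: "r < 2 ^ r" by (rule less_exp)
  \<comment> \<open>Half of \<open>n\<close>, a lower bound for each of the \<open>r + 1\<close>
    largest factors of \<open>fact n\<close>.\<close>
  let ?c = "2 ^ (14 * r - 1) :: nat"
  have n: "n = 2 * ?c" unfolding n_def using r by (simp flip: power_Suc)
  have "2 ^ r \<le> ?c" using r by (intro power_increasing) auto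
  then have "?c + Suc r \<le> n + 1" using rn n by linarith
  have "g * (?L * fact (n - Suc r)) \<le> 2 ^ (13 * r\<^sup>2) * fact (n - Suc r)"
    using gL by (simp only: mult.assoc[symmetric] mult_le_mono1)
  also have "\<dots> < ?c ^ Suc r * fact (n - Suc r)"
  proof -
    have "13 * r\<^sup>2 < (14 * r - 1) * Suc r"
      using r by (cases r) (auto simp: power2_eq_square algebra_simps)
    then have "2 ^ (13 * r\<^sup>2) < ?c ^ Suc r"
      unfolding power_mult[symmetric] by (intro power_strict_increasing) auto
    then show ?thesis by simp
  qed
  also have "\<dots> \<le> fact n" using \<open>?c + Suc r \<le> n + 1\<close> by (rule power_mult_fact_le)
  finally show "g * (?L * fact (n - Suc r)) < fact n" .

  have "(1 - 1 / 2 ^ r :: real) ^ k = ((1 - 1 / real (2 ^ r)) ^ 2 ^ r) ^ 2 ^ r"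
    by (simp add: k_def power_mult)
  also have "\<dots> \<le> (1 / 2) ^ 2 ^ r"
    using one_minus_inverse_power_le[of "2 ^ r"] by (intro power_mono) auto
  finally have err: "(1 - 1 / 2 ^ r :: real) ^ k \<le> (1 / 2) ^ 2 ^ r" .
  have gL': "real g * real ?L \<le> 2 ^ (13 * r\<^sup>2)"
    using gL by (metis of_nat_le_iff of_nat_mult of_nat_numeral of_nat_power)
  have "real g * (real (2 * ?L) * (2 ^ (2 * n) * (1 - 1 / 2 ^ r) ^ k))
      = (real g * real ?L) * (2 * 2 ^ (2 * n) * (1 - 1 / 2 ^ r) ^ k)" by simp
  also have "\<dots> \<le> 2 ^ (13 * r\<^sup>2) * (2 * 2 ^ (2 * n) * (1 / 2) ^ 2 ^ r)"
    using gL' err by (intro mult_mono) auto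
  also have "\<dots> = 2 ^ (2 * n - 2 * r - 1) * (2 ^ (13 * r\<^sup>2 + 2 * r + 2) / 2 ^ 2 ^ r)"
  proof -
    \<comment> \<open>The truncated subtraction is exact because \<open>r\<close> is small against
      \<open>n\<close>.\<close>
    have "2 * n = (2 * n - 2 * r - 1) + (2 * r + 1)"
      using \<open>2 ^ r \<le> ?c\<close> rn n by linarith
    then have "(2 :: real) ^ (2 * n) = 2 ^ (2 * n - 2 * r - 1) * 2 ^ (2 * r + 1)"
      by (metis power_add)
    then show ?thesis by (simp add: power_add power_divide)
  qed
  also have "\<dots> < 2 ^ (2 * n - 2 * r - 1) * 1"
  proof (rule mult_strict_left_mono)
    have "13 * r\<^sup>2 + 2 * r + 2 < 2 ^ r" using r2 rr r by linarith
    then have "(2 :: real) ^ (13 * r\<^sup>2 + 2 * r + 2) < 2 ^ 2 ^ r"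
      by (intro power_strict_increasing) auto
    then show "(2 :: real) ^ (13 * r\<^sup>2 + 2 * r + 2) / 2 ^ 2 ^ r < 1" by simp
  qed simp
  finally show "real g * (real (2 * ?L) * (2 ^ (2 * n) * (1 - 1 / 2 ^ r) ^ k)) < 2 ^ (2 * n - 2 * r - 1)"
    by simp
qed

section \<open>Contradiction with a polynomial size bound\<close>

theorem theorem6p5:
  shows "\<not> (\<exists>p :: real poly. \<forall>F :: ('v :: infinite) clause_set. is_clause_set F \<longrightarrow>
    (\<exists>F' :: 'v clause_set. is_cnf_representation F' F \<and>
       real (num_lits F') \<le> poly p (real (num_lits F)) \<and> rel_hd (var F) F' \<le> 1))"
proof
  assume "\<exists>p :: real poly. \<forall>F :: 'v clause_set. is_clause_set F \<longrightarrow>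
    (\<exists>F' :: 'v clause_set. is_cnf_representation F' F \<and>
       real (num_lits F') \<le> poly p (real (num_lits F)) \<and> rel_hd (var F) F' \<le> 1)"
  then obtain p :: "real poly" where p: "\<forall>F :: 'v clause_set. is_clause_set F \<longrightarrow>
    (\<exists>F' :: 'v clause_set. is_cnf_representation F' F \<and>
       real (num_lits F') \<le> poly p (real (num_lits F)) \<and> rel_hd (var F) F' \<le> 1)" ..
  obtain a d where ad: "\<And>x. 0 \<le> x \<Longrightarrow> poly p x \<le> 2 ^ a * (x + 1) ^ d"
    using poly_upper_bound[of p] by blast
  obtain h :: "nat \<Rightarrow> 'v" where h: "inj h"
    using infinite_countable_subset[OF infinite_UNIV] by blast
  \<comment> \<open>The system has fewer than \<open>2 ^ (31 * r)\<close> literals, so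
    \<open>p\<close> bounds \<open>num_lits F'\<close> by \<open>2 ^ (a + 31 * r * d)\<close> and
    the gate count by \<open>2 ^ (4 * a + 124 * r * d + 5)\<close>. The choice of \<open>r\<close>
    puts this exponent below \<open>r\<^sup>2\<close>; the summand 16 also provides the threshold in
    \<open>gates_too_few\<close>.\<close>
  define r where "r = 4 * a + 124 * d + 16"
  define n :: nat where "n = 2 ^ (14 * r)"
  define k :: nat where "k = 2 ^ r * 2 ^ r"
  interpret odd_factor_system h n by unfold_locales (use h in \<open>auto simp: n_def\<close>)
  obtain F' where F': "is_cnf_representation F' system"
    "real (num_lits F') \<le> poly p (real (num_lits system))" "rel_hd (var system) F' \<le> 1"
    using p is_clause_set_system by blast
  define g where "g = 2 * (num_lits F' + 1) ^ 4"
  have "real (num_lits F') \<le> 2 ^ (a + 31 * r * d)"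
  proof -
    have "num_lits system \<le> 2 * (n * n) + 2 * n"
      using num_lits_system by (simp only: distrib_left mult.assoc mult_1_right)
    moreover have "1 \<le> n" "n \<le> n * n" using n_pos by auto
    ultimately have "num_lits system + 1 \<le> 8 * (n * n)" by linarith
    also have "8 = (2 :: nat) ^ 3" by simp
    also have "2 ^ 3 * (n * n) = 2 ^ (3 + (14 * r + 14 * r))" by (simp only: n_def power_add)
    also have "\<dots> \<le> 2 ^ (31 * r)" by (intro power_increasing) (auto simp: r_def)
    finally have "real (num_lits system + 1) \<le> real (2 ^ (31 * r))" by (rule of_nat_mono)
    then have le: "real (num_lits system) + 1 \<le> 2 ^ (31 * r)" by simp
    have "poly p (real (num_lits system)) \<le> 2 ^ a * (real (num_lits system) + 1) ^ d"
      by (rule ad) simp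
    also have "\<dots> \<le> 2 ^ a * (2 ^ (31 * r)) ^ d"
      using le by (intro mult_left_mono power_mono) auto
    also have "\<dots> = 2 ^ (a + 31 * r * d)" by (simp add: power_add power_mult)
    finally show ?thesis using F'(2) by linarith
  qed
  then have "num_lits F' \<le> 2 ^ (a + 31 * r * d)"
    by (metis of_nat_le_iff of_nat_numeral of_nat_power)
  moreover have "(1 :: nat) \<le> 2 ^ (a + 31 * r * d)" by simp
  ultimately have "num_lits F' + 1 \<le> 2 * 2 ^ (a + 31 * r * d)" by linarith
  then have "num_lits F' + 1 \<le> 2 ^ (a + 31 * r * d + 1)" by simp
  then have "g \<le> 2 * (2 ^ (a + 31 * r * d + 1)) ^ 4"
    unfolding g_def by (intro mult_left_mono power_mono) auto
  also have "\<dots> = 2 ^ Suc ((a + 31 * r * d + 1) * 4)" by (simp only: power_mult power_Suc)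
  also have "\<dots> \<le> 2 ^ (r\<^sup>2)"
  proof (rule power_increasing)
    have "1 \<le> r" by (simp add: r_def)
    then have "4 * a \<le> r * (4 * a)" "5 \<le> r * 16" by auto
    moreover have "Suc ((a + 31 * r * d + 1) * 4) = 4 * a + 124 * r * d + 5" by simp
    \<comment> \<open>Only one of the two factors \<open>r\<close> is unfolded, to compare the
      exponents term by term.\<close>
    moreover have "r\<^sup>2 = r * (4 * a) + 124 * r * d + r * 16"
      unfolding power2_eq_square by (subst (2) r_def) (simp add: algebra_simps)
    ultimately show "Suc ((a + 31 * r * d + 1) * 4) \<le> r\<^sup>2" by linarith
  qed simp
  finally have g: "g \<le> 2 ^ (r\<^sup>2)" .
  have "r < 2 ^ r" by (rule less_exp)
  also have "\<dots> \<le> n" unfolding n_def by (intro power_increasing) auto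
  finally have "r < n" .
  then have "fact n \<le> g * ((((2 * r * k)\<^sup>2) ^ r)\<^sup>2 * fact (n - Suc r)) \<or>
    2 ^ (2 * n - 2 * r - 1) \<le> real g *
      (real (2 * (((2 * r * k)\<^sup>2) ^ r)\<^sup>2) * (2 ^ (2 * n) * (1 - 1 / 2 ^ r) ^ k))"
    using F' unfolding g_def by (intro size_lower_bound) (auto simp: r_def k_def)
  moreover have "16 \<le> r" by (simp add: r_def)
  note gates_too_few[OF this g, folded n_def k_def]
  ultimately show False by linarith
qed

end
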